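(* Let $\Omega\in\{\Omega_A,\Omega_B,\Omega_C\}$. Then the three elements \[ \alpha,\qquad \beta,\qquad 256\,\Omega+3(4\delta-3)(4\delta+1) \] generate the two-sided ideal $\ker\sharp$ of $\Re$, and they form a minimal generating set: no one of them lies in the two-sided ideal of $\Re$ generated by the other two.
   Context: All algebras are unital associative over $\mathbb C$, $[x,y]=xy-yx$, $\mathbf i=\sqrt{-1}$. $U(\mathfrak{sl}_2)$ is generated by $E,F,H$ with $[H,E]=2E$, $[H,F]=-2F$, $[E,F]=H$; $\Lambda=EF+FE+\frac{H^2}{2}$. $\Re$ is generated by $A,B,C,\Delta$ with $[A,B]=[B,C]=[C,A]=2\Delta$ and with $\alpha=[A,\Delta]+AC-BA$, $\beta=[B,\Delta]+BA-CB$, $\gamma=[C,\Delta]+CB-AC$ central; $\delta=A+B+C$ (central). The Casimir elements are $\Omega_A=\Delta^2+\tfrac{BAC+CAB}{2}+A^2+B\gamma-C\beta-A\delta$, $\Omega_B=\Delta^2+\tfrac{CBA+ABC}{2}+B^2+C\alpha-A\gamma-B\delta$, $\Omega_C=\Delta^2+\tfrac{ACB+BCA}{2}+C^2+A\beta-B\alpha-C\delta$ (central in $\Re$). $\sharp:\Re\to U(\mathfrak{sl}_2)$ is the unique algebra homomorphism with $A\mapsto \frac{(E+F-2)(E+F+2)}{16}$, $B\mapsto\frac{(H-2)(H+2)}{16}$, $C\mapsto\frac{(\mathbf iE-\mathbf iF-2)(\mathbf iE-\mathbf iF+2)}{16}$, $\Delta\mapsto\frac{(H+2)F^2-(H-2)E^2}{64}$.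 *)

theory Defs
  imports Complex_Main
begin

text \<open>A noncommutative polynomial in variables of type 'v is a finitely supported
  function from words (lists of variables) to complex coefficients.  Algebras given by
  generators and relations are handled through the free algebra: an element of the
  presented algebra is represented by any of its lifts, and an ideal of the presented
  algebra corresponds to an ideal of the free algebra containing the defining relations.\<close>

type_synonym 'v ncp = "'v list \<Rightarrow> complex"

definition ncpolys :: "'v ncp set" where
  "ncpolys = {p. finite {w. p w \<noteq> 0}}"

definition ncconst :: "complex \<Rightarrow> 'v ncp" where
  "ncconst c = (\<lambda>w. if w = [] then c else 0)"

definition ncvar :: "'v \<Rightarrow> 'v ncp" where
  "ncvar x = (\<lambda>w. if w = [x] then 1 else 0)"

definition ncadd :: "'v ncp \<Rightarrow> 'v ncp \<Rightarrow> 'v ncp" (infixl \<open>\<oplus>\<close> 65) where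
  "p \<oplus> q = (\<lambda>w. p w + q w)"

definition ncsub :: "'v ncp \<Rightarrow> 'v ncp \<Rightarrow> 'v ncp" (infixl \<open>\<ominus>\<close> 65) where
  "p \<ominus> q = (\<lambda>w. p w - q w)"

definition ncscale :: "complex \<Rightarrow> 'v ncp \<Rightarrow> 'v ncp" (infixr \<open>\<odot>\<close> 75) where
  "c \<odot> p = (\<lambda>w. c * p w)"

definition ncmul :: "'v ncp \<Rightarrow> 'v ncp \<Rightarrow> 'v ncp" (infixl \<open>\<otimes>\<close> 70) where
  "p \<otimes> q = (\<lambda>w. \<Sum>i\<le>length w. p (take i w) * q (drop i w))"

definition nccomm :: "'v ncp \<Rightarrow> 'v ncp \<Rightarrow> 'v ncp" where
  "nccomm p q = p \<otimes> q \<ominus> q \<otimes> p"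

inductive_set nc_ideal :: "'v ncp set \<Rightarrow> 'v ncp set" for G :: "'v ncp set" where
  gen: "g \<in> G \<Longrightarrow> g \<in> nc_ideal G"
| zero: "ncconst 0 \<in> nc_ideal G"
| add: "a \<in> nc_ideal G \<Longrightarrow> b \<in> nc_ideal G \<Longrightarrow> a \<oplus> b \<in> nc_ideal G"
| mul: "a \<in> nc_ideal G \<Longrightarrow> p \<in> ncpolys \<Longrightarrow> q \<in> ncpolys \<Longrightarrow> p \<otimes> a \<otimes> q \<in> nc_ideal G"

definition wordprod :: "('v \<Rightarrow> 'u ncp) \<Rightarrow> 'v list \<Rightarrow> 'u ncp" where
  "wordprod \<sigma> w = foldr (\<lambda>x r. \<sigma> x \<otimes> r) w (ncconst 1)"

definition ncsubst :: "('v \<Rightarrow> 'u ncp) \<Rightarrow> 'v ncp \<Rightarrow> 'u ncp" where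
  "ncsubst \<sigma> p = (\<lambda>u. \<Sum>w\<in>{w. p w \<noteq> 0}. p w * wordprod \<sigma> w u)"

datatype ugen = GE | GF | GH

abbreviation "uE \<equiv> ncvar GE"
abbreviation "uF \<equiv> ncvar GF"
abbreviation "uH \<equiv> ncvar GH"

definition RelU :: "ugen ncp set" where
  "RelU = { nccomm uH uE \<ominus> 2 \<odot> uE,
            nccomm uH uF \<oplus> 2 \<odot> uF,
            nccomm uE uF \<ominus> uH }"

datatype rgen = GA | GB | GC | GD

abbreviation "rA \<equiv> ncvar GA"
abbreviation "rB \<equiv> ncvar GB"
abbreviation "rC \<equiv> ncvar GC"
abbreviation "rD \<equiv> ncvar GD"

definition ralpha :: "rgen ncp" where
  "ralpha = nccomm rA rD \<oplus> rA \<otimes> rC \<ominus> rB \<otimes> rA"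
definition rbeta :: "rgen ncp" where
  "rbeta = nccomm rB rD \<oplus> rB \<otimes> rA \<ominus> rC \<otimes> rB"
definition rgamma :: "rgen ncp" where
  "rgamma = nccomm rC rD \<oplus> rC \<otimes> rB \<ominus> rA \<otimes> rC"
definition rdelta :: "rgen ncp" where
  "rdelta = rA \<oplus> rB \<oplus> rC"

definition RelR :: "rgen ncp set" where
  "RelR = { nccomm rA rB \<ominus> 2 \<odot> rD,
            nccomm rB rC \<ominus> 2 \<odot> rD,
            nccomm rC rA \<ominus> 2 \<odot> rD }
        \<union> { nccomm z (ncvar x) | z x. z \<in> {ralpha, rbeta, rgamma} }"

definition OmegaA :: "rgen ncp" where
  "OmegaA = rD \<otimes> rD \<oplus> (1/2) \<odot> (rB \<otimes> rA \<otimes> rC \<oplus> rC \<otimes> rA \<otimes> rB) \<oplus> rA \<otimes> rA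
            \<oplus> rB \<otimes> rgamma \<ominus> rC \<otimes> rbeta \<ominus> rA \<otimes> rdelta"
definition OmegaB :: "rgen ncp" where
  "OmegaB = rD \<otimes> rD \<oplus> (1/2) \<odot> (rC \<otimes> rB \<otimes> rA \<oplus> rA \<otimes> rB \<otimes> rC) \<oplus> rB \<otimes> rB
            \<oplus> rC \<otimes> ralpha \<ominus> rA \<otimes> rgamma \<ominus> rB \<otimes> rdelta"
definition OmegaC :: "rgen ncp" where
  "OmegaC = rD \<otimes> rD \<oplus> (1/2) \<odot> (rA \<otimes> rC \<otimes> rB \<oplus> rB \<otimes> rC \<otimes> rA) \<oplus> rC \<otimes> rC
            \<oplus> rA \<otimes> rbeta \<ominus> rB \<otimes> ralpha \<ominus> rC \<otimes> rdelta"

fun sharp_gen :: "rgen \<Rightarrow> ugen ncp" where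
  "sharp_gen GA = (1/16) \<odot> ((uE \<oplus> uF \<ominus> ncconst 2) \<otimes> (uE \<oplus> uF \<oplus> ncconst 2))"
| "sharp_gen GB = (1/16) \<odot> ((uH \<ominus> ncconst 2) \<otimes> (uH \<oplus> ncconst 2))"
| "sharp_gen GC = (1/16) \<odot> ((\<i> \<odot> uE \<ominus> \<i> \<odot> uF \<ominus> ncconst 2) \<otimes> (\<i> \<odot> uE \<ominus> \<i> \<odot> uF \<oplus> ncconst 2))"
| "sharp_gen GD = (1/64) \<odot> ((uH \<oplus> ncconst 2) \<otimes> uF \<otimes> uF \<ominus> (uH \<ominus> ncconst 2) \<otimes> uE \<otimes> uE)"

text \<open>Lift of ker(sharp) to the free algebra on A,B,C,Delta: the kernel of the composite
  free algebra -> U(sl_2).\<close>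
definition ker_sharp_lift :: "rgen ncp set" where
  "ker_sharp_lift = {p \<in> ncpolys. ncsubst sharp_gen p \<in> nc_ideal RelU}"

definition third_gen :: "rgen ncp \<Rightarrow> rgen ncp" where
  "third_gen \<Omega> = 256 \<odot> \<Omega> \<oplus> 3 \<odot> ((4 \<odot> rdelta \<ominus> ncconst 3) \<otimes> (4 \<odot> rdelta \<oplus> ncconst 1))"

end

theory Submission
  imports Defs
begin

text \<open>U(sl2) acts faithfully on functions of a weight \<open>m\<close>, with the eigenvalue \<open>l\<close> of the Casimir
  element as a parameter; so the kernel consists of the elements acting as zero for all \<open>l\<close>, and
  checking that a given element lies in it is a polynomial computation.  Conversely, modulo
  \<open>\<alpha>\<close>, \<open>\<beta>\<close> and the third element, \<open>\<Re>\<close> is spanned by the monomials \<open>A\<^sup>i \<Delta>\<^sup>j B\<^sup>k \<delta>\<^sup>s\<close> with \<open>j \<le> 1\<close>,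
  because the third element expresses \<open>\<Delta>\<^sup>2\<close> through the others; these monomials act linearly
  independently, as their leading shift terms show.  Minimality is witnessed by one-dimensional
  representations with \<open>\<Delta> = 0\<close>.\<close>

section \<open>The free algebra\<close>

text \<open>For a fixed \<open>l\<close> the Casimir element minus \<open>l\<close> acts as zero, so
  no single one of these modules is faithful; that is why every independence statement ranges over
  all \<open>l\<close>. The third element is what eliminating \<open>l\<close> leaves behind:
  \<delta> acts as \<open>l / 8 - 3 / 4\<close>, and \<open>OmegaA\<close> acts as
  \<open>- 3 / 256 * (l / 2 - 6) * (l / 2 - 2)\<close>, where the two factors are the values of
  4\<delta> - 3 and 4\<delta> + 1. Elements of the quotient algebras are handled only through lifts.
  Hence each rewriting step is an identity in the free algebra that displays the remainder as a
  member of the ideal. One criterion, spanning modulo the ideal together with independence of the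
  operators, serves twice: with PBW monomials it gives faithfulness for U(sl2), and with the normal
  forms of \<Re> it gives the kernel.\<close>

lemma ncmul_assoc: "p \<otimes> q \<otimes> r = p \<otimes> (q \<otimes> r)"
proof
  fix w :: "'a list"
  let ?n = "length w"
  have "(p \<otimes> q \<otimes> r) w
      = (\<Sum>i\<le>?n. \<Sum>j\<le>i. p (take j w) * q (drop j (take i w)) * r (drop i w))"
    unfolding ncmul_def sum_distrib_right
    by (intro sum.cong refl) (auto simp: min_def)
  also have "\<dots> = (\<Sum>(i, j)\<in>(SIGMA i:{..?n}. {..i}). p (take j w) * q (drop j (take i w)) * r (drop i w))"
    by (simp add: sum.Sigma)
  \<comment> \<open>Cutting a word at \<open>i\<close> and its first part at \<open>j\<close> gives
    the same three pieces as cutting it at \<open>j\<close> and the rest at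
    \<open>k = i - j\<close>.\<close>
  also have "\<dots> = (\<Sum>(j, k)\<in>(SIGMA j:{..?n}. {..?n - j}).
      p (take j w) * q (take k (drop j w)) * r (drop k (drop j w)))"
    by (rule sum.reindex_bij_witness[where i = "\<lambda>(j, k). (j + k, j)" and j = "\<lambda>(i, j). (j, i - j)"])
       (auto simp: drop_take add.commute)
  also have "\<dots> = (p \<otimes> (q \<otimes> r)) w"
    unfolding ncmul_def by (simp add: sum.Sigma [symmetric] sum_distrib_left mult.assoc)
  finally show "(p \<otimes> q \<otimes> r) w = (p \<otimes> (q \<otimes> r)) w" .
qed

lemma ncmul_distribs:
  "(p \<oplus> q) \<otimes> r = p \<otimes> r \<oplus> q \<otimes> r"  "r \<otimes> (p \<oplus> q) = r \<otimes> p \<oplus> r \<otimes> q"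
  "(p \<ominus> q) \<otimes> r = p \<otimes> r \<ominus> q \<otimes> r"  "r \<otimes> (p \<ominus> q) = r \<otimes> p \<ominus> r \<otimes> q"
  "(c \<odot> p) \<otimes> r = c \<odot> (p \<otimes> r)"  "r \<otimes> (c \<odot> p) = c \<odot> (r \<otimes> p)"
  by (rule ext, simp add: ncmul_def ncadd_def ncsub_def ncscale_def algebra_simps
      sum.distrib sum_subtractf sum_distrib_left)+

lemma ncconst_mul: "ncconst c \<otimes> p = c \<odot> p"
proof
  fix w :: "'a list"
  have "(ncconst c \<otimes> p) w = (\<Sum>i\<in>{0}. ncconst c (take i w) * p (drop i w))"
    unfolding ncmul_def by (rule sum.mono_neutral_right) (auto simp: ncconst_def)
  then show "(ncconst c \<otimes> p) w = (c \<odot> p) w" by (simp add: ncconst_def ncscale_def)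
qed

lemma mul_ncconst: "p \<otimes> ncconst c = c \<odot> p"
proof
  fix w :: "'a list"
  have "(p \<otimes> ncconst c) w = (\<Sum>i\<in>{length w}. p (take i w) * ncconst c (drop i w))"
    unfolding ncmul_def by (rule sum.mono_neutral_right) (auto simp: ncconst_def)
  then show "(p \<otimes> ncconst c) w = (c \<odot> p) w" by (simp add: ncconst_def ncscale_def)
qed

lemma ncvar_mul: "(ncvar x \<otimes> p) w = (case w of [] \<Rightarrow> 0 | y # u \<Rightarrow> if x = y then p u else 0)"
proof (cases w)
  case Nil
  then show ?thesis by (simp add: ncmul_def ncvar_def)
next
  case (Cons y u)
  have "(ncvar x \<otimes> p) w = (\<Sum>i\<in>{1}. ncvar x (take i w) * p (drop i w))"
    unfolding ncmul_def
    by (rule sum.mono_neutral_right) (auto simp: ncvar_def Cons take_Cons' split: if_splits)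
  then show ?thesis by (simp add: Cons ncvar_def)
qed

lemmas nc_ring_simps = ncmul_assoc ncmul_distribs ncconst_mul mul_ncconst

lemmas nc_pointwise = ncadd_def ncsub_def ncscale_def

text \<open>Evaluated at a word, a fully expanded identity becomes linear in the values of the
  products, so commutative simplification decides it.\<close>
lemma nc_apply:
  "(p \<oplus> q) w = p w + q w"  "(p \<ominus> q) w = p w - q w"  "(c \<odot> p) w = c * p w"
  by (simp_all add: nc_pointwise)

lemma ncscale_one [simp]: "1 \<odot> p = p"
  by (simp add: ncscale_def)

lemma ncpolys_const [simp]: "ncconst c \<in> ncpolys"
  by (simp add: ncpolys_def ncconst_def)

lemma ncpolys_var [simp]: "ncvar x \<in> ncpolys"
  by (simp add: ncpolys_def ncvar_def)

lemma ncpolys_add [simp]: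
  assumes "p \<in> ncpolys" "q \<in> ncpolys" shows "p \<oplus> q \<in> ncpolys"
proof -
  have "{w. (p \<oplus> q) w \<noteq> 0} \<subseteq> {w. p w \<noteq> 0} \<union> {w. q w \<noteq> 0}"
    by (auto simp: ncadd_def)
  then show ?thesis using assms unfolding ncpolys_def by (simp add: finite_subset)
qed

lemma ncpolys_scale [simp]: "p \<in> ncpolys \<Longrightarrow> c \<odot> p \<in> ncpolys"
  unfolding ncpolys_def ncscale_def by (simp add: finite_subset[of _ "{w. p w \<noteq> 0}"])

lemma ncsub_conv: "p \<ominus> q = p \<oplus> (-1) \<odot> q"
  by (simp add: nc_pointwise)

lemma ncpolys_sub [simp]: "p \<in> ncpolys \<Longrightarrow> q \<in> ncpolys \<Longrightarrow> p \<ominus> q \<in> ncpolys"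
  by (simp add: ncsub_conv)

lemma ncpolys_mul [simp]:
  assumes "p \<in> ncpolys" "q \<in> ncpolys" shows "p \<otimes> q \<in> ncpolys"
proof -
  have "{w. (p \<otimes> q) w \<noteq> 0} \<subseteq> (\<lambda>(u, v). u @ v) ` ({w. p w \<noteq> 0} \<times> {w. q w \<noteq> 0})"
  proof
    fix w assume "w \<in> {w. (p \<otimes> q) w \<noteq> 0}"
    then obtain i where "p (take i w) * q (drop i w) \<noteq> 0"
      unfolding ncmul_def by (metis (mono_tags, lifting) mem_Collect_eq sum.neutral)
    then show "w \<in> (\<lambda>(u, v). u @ v) ` ({w. p w \<noteq> 0} \<times> {w. q w \<noteq> 0})"
      by (intro image_eqI[of _ _ "(take i w, drop i w)"]) auto
  qed
  then show ?thesis using assms unfolding ncpolys_def by (simp add: finite_subset)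
qed

lemma ncpolys_nccomm [simp]: "p \<in> ncpolys \<Longrightarrow> q \<in> ncpolys \<Longrightarrow> nccomm p q \<in> ncpolys"
  by (simp add: nccomm_def)

text \<open>Left multiplication by a variable is the only product in the rule because words grow by
  \<open>Cons\<close>; this matches the recursion of \<open>foldr\<close> in \<open>act\<close> and
  \<open>wordprod\<close>.\<close>

lemma ncpolys_induct [consumes 1, case_names one var add scale]:
  assumes "p \<in> ncpolys"
    and one: "P (ncconst 1)"
    and var: "\<And>x p. p \<in> ncpolys \<Longrightarrow> P p \<Longrightarrow> P (ncvar x \<otimes> p)"
    and add: "\<And>p q. p \<in> ncpolys \<Longrightarrow> q \<in> ncpolys \<Longrightarrow> P p \<Longrightarrow> P q \<Longrightarrow> P (p \<oplus> q)"
    and scale: "\<And>c p. p \<in> ncpolys \<Longrightarrow> P p \<Longrightarrow> P (c \<odot> p)"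
  shows "P p"
proof -
  define mono :: "'a list \<Rightarrow> 'a ncp" where "mono w = (\<lambda>u. if u = w then 1 else 0)" for w
  have mono: "mono w \<in> ncpolys \<and> P (mono w)" for w
  proof (induction w)
    case Nil
    have "mono [] = ncconst 1" by (simp add: mono_def ncconst_def)
    then show ?case using one by simp
  next
    case (Cons x w)
    have "mono (x # w) = ncvar x \<otimes> mono w"
      by (rule ext) (auto simp: ncvar_mul mono_def split: list.split)
    then show ?case using Cons var by simp
  qed
  have "finite S \<Longrightarrow> (\<lambda>u. \<Sum>w\<in>S. p w * mono w u) \<in> ncpolys \<and> P (\<lambda>u. \<Sum>w\<in>S. p w * mono w u)" for S
  proof (induction S rule: finite_induct)
    case empty
    have "(\<lambda>u. \<Sum>w\<in>{}. p w * mono w u) = 0 \<odot> mono []" by (simp add: ncscale_def)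
    then show ?case using mono scale by (metis ncpolys_scale)
  next
    case (insert w S)
    have "(\<lambda>u. \<Sum>w\<in>insert w S. p w * mono w u) = p w \<odot> mono w \<oplus> (\<lambda>u. \<Sum>w\<in>S. p w * mono w u)"
      using insert by (simp add: nc_pointwise)
    then show ?case using insert mono scale add by simp
  qed
  moreover have "(\<lambda>u. \<Sum>w | p w \<noteq> 0. p w * mono w u) = p"
  proof
    fix u
    have "(\<Sum>w | p w \<noteq> 0. p w * mono w u) = (\<Sum>w | p w \<noteq> 0. if u = w then p u else 0)"
      by (intro sum.cong) (auto simp: mono_def)
    then show "(\<Sum>w | p w \<noteq> 0. p w * mono w u) = p u"
      using \<open>p \<in> ncpolys\<close> by (simp add: ncpolys_def)
  qed
  moreover have "finite {w. p w \<noteq> 0}" using \<open>p \<in> ncpolys\<close> by (simp add: ncpolys_def)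
  ultimately show ?thesis by metis
qed

section \<open>Actions of the free algebra\<close>

definition linop :: "(('t \<Rightarrow> complex) \<Rightarrow> 's \<Rightarrow> complex) \<Rightarrow> bool" where
  "linop L \<longleftrightarrow> (\<forall>f g. L (\<lambda>t. f t + g t) = (\<lambda>t. L f t + L g t)) \<and>
     (\<forall>c f. L (\<lambda>t. c * f t) = (\<lambda>t. c * L f t))"

text \<open>Vectors are functions on an arbitrary index type so that one notion covers weight
  modules (index \<open>complex\<close>), one-dimensional modules (index \<open>unit\<close>) and
  the free algebra acting on another free algebra (index words).\<close>

definition act :: "('v \<Rightarrow> ('t \<Rightarrow> complex) \<Rightarrow> 't \<Rightarrow> complex) \<Rightarrow> 'v ncp \<Rightarrow> ('t \<Rightarrow> complex) \<Rightarrow> 't \<Rightarrow> complex"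
  where "act \<rho> p f = (\<lambda>t. \<Sum>w | p w \<noteq> 0. p w * foldr \<rho> w f t)"

lemma linop_add: "linop L \<Longrightarrow> L (\<lambda>t. f t + g t) = (\<lambda>t. L f t + L g t)"
  and linop_scale: "linop L \<Longrightarrow> L (\<lambda>t. c * f t) = (\<lambda>t. c * L f t)"
  by (auto simp: linop_def)

lemma linop_zero: "linop L \<Longrightarrow> L (\<lambda>t. 0) = (\<lambda>t. 0)"
  using linop_scale[of L 0] by simp

lemma linop_sum:
  assumes "linop L" shows "L (\<lambda>t. \<Sum>w\<in>S. c w * h w t) = (\<lambda>t. \<Sum>w\<in>S. c w * L (h w) t)"
  by (induction S rule: infinite_finite_induct)
     (simp_all add: linop_zero[OF assms] linop_add[OF assms, of "\<lambda>t. c _ * h _ t"] linop_scale[OF assms])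

lemma act_superset:
  assumes "finite S" "{w. p w \<noteq> 0} \<subseteq> S"
  shows "act \<rho> p f t = (\<Sum>w\<in>S. p w * foldr \<rho> w f t)"
  unfolding act_def using assms by (intro sum.mono_neutral_left) auto

lemma act_add:
  assumes "p \<in> ncpolys" "q \<in> ncpolys"
  shows "act \<rho> (p \<oplus> q) f = (\<lambda>t. act \<rho> p f t + act \<rho> q f t)"
proof
  fix t
  let ?S = "{w. p w \<noteq> 0} \<union> {w. q w \<noteq> 0}"
  have "finite ?S" using assms by (simp add: ncpolys_def)
  moreover have "{w. (p \<oplus> q) w \<noteq> 0} \<subseteq> ?S" by (auto simp: ncadd_def)
  ultimately show "act \<rho> (p \<oplus> q) f t = act \<rho> p f t + act \<rho> q f t"
    by (simp add: act_superset[of ?S] ncadd_def sum.distrib[symmetric] distrib_right)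
qed

lemma act_scale:
  assumes "p \<in> ncpolys"
  shows "act \<rho> (c \<odot> p) f = (\<lambda>t. c * act \<rho> p f t)"
proof
  fix t
  let ?S = "{w. p w \<noteq> 0}"
  have "finite ?S" using assms by (simp add: ncpolys_def)
  moreover have "{w. (c \<odot> p) w \<noteq> 0} \<subseteq> ?S" by (auto simp: ncscale_def)
  ultimately show "act \<rho> (c \<odot> p) f t = c * act \<rho> p f t"
    by (simp add: act_superset[of ?S] ncscale_def sum_distrib_left mult.assoc)
qed

lemma act_sub:
  "p \<in> ncpolys \<Longrightarrow> q \<in> ncpolys \<Longrightarrow> act \<rho> (p \<ominus> q) f = (\<lambda>t. act \<rho> p f t - act \<rho> q f t)"
  by (simp add: ncsub_conv act_add act_scale)

lemma act_const: "act \<rho> (ncconst c) f = (\<lambda>t. c * f t)"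
  by (rule ext, subst act_superset[of "{[]}"]) (auto simp: ncconst_def)

lemma act_var: "act \<rho> (ncvar x) f = \<rho> x f"
  by (rule ext, subst act_superset[of "{[x]}"]) (auto simp: ncvar_def)

lemma act_var_mul:
  assumes "p \<in> ncpolys" "linop (\<rho> x)"
  shows "act \<rho> (ncvar x \<otimes> p) f = \<rho> x (act \<rho> p f)"
proof
  fix t
  have supp: "{w. (ncvar x \<otimes> p) w \<noteq> 0} = (#) x ` {w. p w \<noteq> 0}"
    by (auto simp: ncvar_mul image_iff split: list.splits if_splits) (metis neq_Nil_conv)
  show "act \<rho> (ncvar x \<otimes> p) f t = \<rho> x (act \<rho> p f) t"
    unfolding act_def supp linop_sum[OF assms(2)]
    by (simp add: sum.reindex ncvar_mul)
qed

lemma act_mul: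
  assumes "p \<in> ncpolys" "q \<in> ncpolys" "\<And>x. linop (\<rho> x)"
  shows "act \<rho> (p \<otimes> q) f = act \<rho> p (act \<rho> q f)"
  using assms(1)
proof (induction p rule: ncpolys_induct)
  case one
  then show ?case by (simp add: ncconst_mul act_scale act_const assms)
next
  case (var x p)
  then show ?case by (simp add: ncmul_assoc act_var_mul assms)
next
  case (add p r)
  then show ?case by (simp add: ncmul_distribs act_add assms)
next
  case (scale c p)
  then show ?case by (simp add: ncmul_distribs act_scale assms)
qed

lemmas act_simps = act_add act_sub act_scale act_mul act_const act_var

lemma linop_act:
  assumes "\<And>x. linop (\<rho> x)"
  shows "linop (act \<rho> p)"
proof -
  have "linop (foldr \<rho> w)" for w
    by (induction w) (use assms in \<open>simp_all add: linop_def\<close>)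
  then show ?thesis
    unfolding linop_def act_def
    by (auto simp: sum.distrib[symmetric] sum_distrib_left algebra_simps)
qed

text \<open>Substitution is the action by left multiplication with the images of the variables,
  applied to 1. Its compatibility with sums and products is thereby inherited from
  \<open>act\<close>.\<close>

lemma ncsubst_conv_act: "ncsubst \<sigma> p = act (\<lambda>x r. \<sigma> x \<otimes> r) p (ncconst 1)"
  by (simp add: ncsubst_def act_def wordprod_def)

lemma linop_ncmul: "linop (\<lambda>r. p \<otimes> r)"
  unfolding linop_def using ncmul_distribs(2,6)[of p] by (simp add: ncadd_def ncscale_def)

text \<open>A representation is pulled back along a substitution. Both claims share one induction,
  since \<open>act_mul\<close> needs the substituted polynomial to have finite support.\<close>

lemma
  assumes "p \<in> ncpolys" "\<And>x. \<sigma> x \<in> ncpolys"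
  shows ncpolys_ncsubst: "ncsubst \<sigma> p \<in> ncpolys"
    and act_ncsubst: "(\<And>x. linop (\<rho> x)) \<Longrightarrow> act \<rho> (ncsubst \<sigma> p) f = act (\<lambda>x. act \<rho> (\<sigma> x)) p f"
proof -
  have "ncsubst \<sigma> p \<in> ncpolys \<and> ((\<forall>x. linop (\<rho> x)) \<longrightarrow>
      (\<forall>f. act \<rho> (ncsubst \<sigma> p) f = act (\<lambda>x. act \<rho> (\<sigma> x)) p f))"
    using assms(1)
  proof (induction p rule: ncpolys_induct)
    case one
    have "ncsubst \<sigma> (ncconst 1) = ncconst 1" by (simp add: ncsubst_conv_act act_const)
    then show ?case by (simp add: act_const)
  next
    case (var x p)
    have "ncsubst \<sigma> (ncvar x \<otimes> p) = \<sigma> x \<otimes> ncsubst \<sigma> p"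
      by (simp add: ncsubst_conv_act act_var_mul var linop_ncmul)
    with var show ?case by (simp add: assms act_mul act_var linop_act)
  next
    case (add p q)
    have "ncsubst \<sigma> (p \<oplus> q) = ncsubst \<sigma> p \<oplus> ncsubst \<sigma> q"
      by (simp add: ncsubst_conv_act act_add add) (simp add: ncadd_def)
    with add show ?case by (simp add: act_add)
  next
    case (scale c p)
    have "ncsubst \<sigma> (c \<odot> p) = c \<odot> ncsubst \<sigma> p"
      by (simp add: ncsubst_conv_act act_scale scale) (simp add: ncscale_def)
    with scale show ?case by (simp add: act_scale)
  qed
  then show "ncsubst \<sigma> p \<in> ncpolys"
    "(\<And>x. linop (\<rho> x)) \<Longrightarrow> act \<rho> (ncsubst \<sigma> p) f = act (\<lambda>x. act \<rho> (\<sigma> x)) p f"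
    by auto
qed

section \<open>Ideals and spanning sets modulo ideals\<close>

text \<open>Finite support is carried through the induction because \<open>act_add\<close> and
  \<open>act_mul\<close> ask for it.\<close>

lemma nc_ideal_annihilated:
  assumes "p \<in> nc_ideal G" "G \<subseteq> ncpolys" "\<And>x. linop (\<rho> x)"
    and "\<And>g f. g \<in> G \<Longrightarrow> act \<rho> g f = (\<lambda>t. 0)"
  shows "p \<in> ncpolys \<and> (\<forall>f. act \<rho> p f = (\<lambda>t. 0))"
  using assms(1)
  by (induction rule: nc_ideal.induct)
     (use assms in \<open>auto simp: act_const act_add act_mul linop_zero[OF linop_act]\<close>)

lemma nc_ideal_lmul: "a \<in> nc_ideal G \<Longrightarrow> p \<in> ncpolys \<Longrightarrow> p \<otimes> a \<in> nc_ideal G"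
  using nc_ideal.mul[of a G p "ncconst 1"] by (simp add: mul_ncconst ncscale_def)

lemma nc_ideal_rmul: "a \<in> nc_ideal G \<Longrightarrow> p \<in> ncpolys \<Longrightarrow> a \<otimes> p \<in> nc_ideal G"
  using nc_ideal.mul[of a G "ncconst 1" p] by (simp add: ncconst_mul ncscale_def)

lemma nc_ideal_scale: "a \<in> nc_ideal G \<Longrightarrow> c \<odot> a \<in> nc_ideal G"
  using nc_ideal_lmul[of a G "ncconst c"] by (simp add: ncconst_mul)

lemma nc_ideal_sub: "a \<in> nc_ideal G \<Longrightarrow> b \<in> nc_ideal G \<Longrightarrow> a \<ominus> b \<in> nc_ideal G"
  by (simp add: ncsub_conv nc_ideal.add nc_ideal_scale)

lemmas nc_ideal_intros = nc_ideal.add nc_ideal_sub nc_ideal_scale nc_ideal_lmul nc_ideal_rmul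

definition lincomb :: "('i \<Rightarrow> 'v ncp) \<Rightarrow> ('i \<Rightarrow> complex) \<Rightarrow> 'v ncp" where
  "lincomb g c = (\<lambda>w. \<Sum>t | c t \<noteq> 0. c t * g t w)"

definition span_mod :: "'v ncp set \<Rightarrow> ('i \<Rightarrow> 'v ncp) \<Rightarrow> 'v ncp set" where
  "span_mod G g = {p. \<exists>c. finite {t. c t \<noteq> 0} \<and> p \<ominus> lincomb g c \<in> nc_ideal G}"

lemma lincomb_superset:
  "finite S \<Longrightarrow> {t. c t \<noteq> 0} \<subseteq> S \<Longrightarrow> lincomb g c w = (\<Sum>t\<in>S. c t * g t w)"
  unfolding lincomb_def by (intro sum.mono_neutral_left) auto

lemma span_mod_gen: "g t \<in> span_mod G g"
proof -
  let ?c = "\<lambda>u. if u = t then 1 else 0"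
  have "lincomb g ?c = g t"
    by (rule ext, subst lincomb_superset[of "{t}"]) auto
  then have "g t \<ominus> lincomb g ?c = ncconst 0" by (simp add: ncsub_def ncconst_def)
  then show ?thesis unfolding span_mod_def
    by (auto intro!: exI[of _ ?c] simp: nc_ideal.zero)
qed

lemma span_mod_add:
  assumes "p \<in> span_mod G g" "q \<in> span_mod G g" shows "p \<oplus> q \<in> span_mod G g"
proof -
  from assms obtain c d where
    c: "finite {t. c t \<noteq> 0}" "p \<ominus> lincomb g c \<in> nc_ideal G" and
    d: "finite {t. d t \<noteq> 0}" "q \<ominus> lincomb g d \<in> nc_ideal G"
    unfolding span_mod_def by blast
  let ?S = "{t. c t \<noteq> 0} \<union> {t. d t \<noteq> 0}" and ?e = "\<lambda>t. c t + d t"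
  have e: "{t. ?e t \<noteq> 0} \<subseteq> ?S" and S: "finite ?S" using c d by auto
  have "p \<oplus> q \<ominus> lincomb g ?e = (p \<ominus> lincomb g c) \<oplus> (q \<ominus> lincomb g d)"
    by (rule ext) (simp add: nc_pointwise lincomb_superset[OF S e] lincomb_superset[OF S Un_upper1]
        lincomb_superset[OF S Un_upper2] algebra_simps sum.distrib)
  then have "p \<oplus> q \<ominus> lincomb g ?e \<in> nc_ideal G" using c d by (simp add: nc_ideal.add)
  then show ?thesis unfolding span_mod_def using finite_subset[OF e S] by (intro CollectI exI[of _ ?e]) simp
qed

lemma span_mod_scale:
  assumes "p \<in> span_mod G g" shows "a \<odot> p \<in> span_mod G g"
proof -
  from assms obtain c where
    c: "finite {t. c t \<noteq> 0}" "p \<ominus> lincomb g c \<in> nc_ideal G"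
    unfolding span_mod_def by blast
  let ?d = "\<lambda>t. a * c t"
  have d: "{t. ?d t \<noteq> 0} \<subseteq> {t. c t \<noteq> 0}" by auto
  have "a \<odot> p \<ominus> lincomb g ?d = a \<odot> (p \<ominus> lincomb g c)"
    by (rule ext) (simp add: nc_pointwise lincomb_superset[OF c(1) d] lincomb_superset[OF c(1) order.refl] algebra_simps sum_distrib_left)
  then have "a \<odot> p \<ominus> lincomb g ?d \<in> nc_ideal G" using c by (simp add: nc_ideal_scale)
  then show ?thesis unfolding span_mod_def using finite_subset[OF d c(1)] by (intro CollectI exI[of _ ?d]) simp
qed

lemma span_mod_sub: "p \<in> span_mod G g \<Longrightarrow> q \<in> span_mod G g \<Longrightarrow> p \<ominus> q \<in> span_mod G g"
  by (simp add: ncsub_conv span_mod_add span_mod_scale)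

lemma span_mod_ideal: "p \<in> nc_ideal G \<Longrightarrow> p \<in> span_mod G g"
  unfolding span_mod_def by (auto intro!: exI[of _ "\<lambda>_. 0"] simp: lincomb_def nc_pointwise)

text \<open>This is a single rewriting step: \<open>q\<close> is what \<open>p\<close> becomes under
  the relations.\<close>

lemma span_mod_cong:
  assumes "q \<in> span_mod G g" "p \<ominus> q \<in> nc_ideal G" shows "p \<in> span_mod G g"
proof -
  have "p = (p \<ominus> q) \<oplus> q" by (simp add: nc_pointwise)
  then show ?thesis using assms span_mod_add span_mod_ideal by metis
qed

lemma span_mod_lmul:
  assumes "p \<in> span_mod G g" "x \<in> ncpolys" "\<And>t. x \<otimes> g t \<in> span_mod G h"
  shows "x \<otimes> p \<in> span_mod G h"
proof -
  from assms obtain c where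
    c: "finite {t. c t \<noteq> 0}" "p \<ominus> lincomb g c \<in> nc_ideal G"
    unfolding span_mod_def by blast
  have "(\<lambda>w. \<Sum>t\<in>S. c t * (x \<otimes> g t) w) \<in> span_mod G h" if "finite S" for S
    using that
  proof (induction S rule: finite_induct)
    case empty
    then show ?case using span_mod_ideal[OF nc_ideal.zero] by (simp add: ncconst_def)
  next
    case (insert t S)
    have "(\<lambda>w. \<Sum>t\<in>insert t S. c t * (x \<otimes> g t) w)
        = c t \<odot> (x \<otimes> g t) \<oplus> (\<lambda>w. \<Sum>t\<in>S. c t * (x \<otimes> g t) w)"
      using insert by (simp add: nc_pointwise)
    then show ?case using insert assms(3) by (simp add: span_mod_add span_mod_scale)
  qed
  moreover have "(\<lambda>w. \<Sum>t | c t \<noteq> 0. c t * (x \<otimes> g t) w) = x \<otimes> lincomb g c"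
    unfolding lincomb_def by (simp add: linop_sum[OF linop_ncmul])
  ultimately have "x \<otimes> lincomb g c \<in> span_mod G h" using c(1) by metis
  moreover have "x \<otimes> p \<ominus> x \<otimes> lincomb g c \<in> nc_ideal G"
    using nc_ideal_lmul[OF c(2) assms(2)] by (simp add: ncmul_distribs)
  ultimately show ?thesis by (rule span_mod_cong)
qed

text \<open>The span is then a left ideal containing 1, so a normal form theorem reduces to
  rewriting one variable times one monomial.\<close>

lemma ncpolys_subset_span_mod:
  assumes "ncconst 1 \<in> span_mod G g" "\<And>x t. ncvar x \<otimes> g t \<in> span_mod G g" "p \<in> ncpolys"
  shows "p \<in> span_mod G g"
  using assms(3)
  by (induction p rule: ncpolys_induct)
     (auto intro: assms span_mod_add span_mod_scale span_mod_lmul)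

text \<open>Modulo the ideal \<open>p\<close> is a combination of the \<open>g t\<close>. That
  combination acts as zero like \<open>p\<close>, so independence kills its coefficients.
  Independence is required only of the whole family indexed by \<open>k\<close>, not of each
  member.\<close>

lemma nc_ideal_if_annihilated:
  fixes \<rho> :: "'k \<Rightarrow> 'v \<Rightarrow> ('t \<Rightarrow> complex) \<Rightarrow> 't \<Rightarrow> complex"
  assumes "G \<subseteq> ncpolys" "\<And>k x. linop (\<rho> k x)" "\<And>k a f. a \<in> G \<Longrightarrow> act (\<rho> k) a f = (\<lambda>t. 0)"
    and "\<And>t. g t \<in> ncpolys" "p \<in> ncpolys"
    and "p \<in> span_mod G g" "\<And>k f. act (\<rho> k) p f = (\<lambda>t. 0)"
    and indep: "\<And>c. finite {t. c t \<noteq> 0} \<Longrightarrow>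
      (\<And>k f s. (\<Sum>t | c t \<noteq> 0. c t * act (\<rho> k) (g t) f s) = 0) \<Longrightarrow> {t. c t \<noteq> 0} = {}"
  shows "p \<in> nc_ideal G"
proof -
  from assms obtain c where
    c: "finite {t. c t \<noteq> 0}" "p \<ominus> lincomb g c \<in> nc_ideal G"
    unfolding span_mod_def by blast
  have sum: "(\<lambda>w. \<Sum>t\<in>S. c t * g t w) \<in> ncpolys \<and>
      act (\<rho> k) (\<lambda>w. \<Sum>t\<in>S. c t * g t w) f = (\<lambda>s. \<Sum>t\<in>S. c t * act (\<rho> k) (g t) f s)"
    if "finite S" for S k f
    using that
  proof (induction S rule: finite_induct)
    case empty
    then show ?case using act_const[of "\<rho> k" 0 f] ncpolys_const[of 0] by (simp add: ncconst_def)
  next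
    case (insert t S)
    have "(\<lambda>w. \<Sum>t\<in>insert t S. c t * g t w) = c t \<odot> g t \<oplus> (\<lambda>w. \<Sum>t\<in>S. c t * g t w)"
      using insert by (simp add: nc_pointwise)
    then show ?case using insert assms(4) by (simp add: act_add act_scale)
  qed
  have "(\<Sum>t | c t \<noteq> 0. c t * act (\<rho> k) (g t) f s) = 0" for k f s
  proof -
    have "act (\<rho> k) (p \<ominus> lincomb g c) f s = 0"
      using nc_ideal_annihilated[OF c(2) assms(1), of "\<rho> k"] assms(2,3) by simp
    then show ?thesis
      using sum[OF c(1)] assms(5,7) by (simp add: act_sub lincomb_def)
  qed
  then have "{t. c t \<noteq> 0} = {}" using indep c(1) by blast
  then have "p \<ominus> lincomb g c = p" by (simp add: lincomb_def nc_pointwise)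
  then show ?thesis using c(2) by simp
qed

section \<open>A faithful family of representations of U(sl2)\<close>

text \<open>The eigenvalue of EF on weight \<open>m\<close>, solved from 2EF - H + H^2/2 = \<Lambda>
  with \<Lambda> = \<open>l\<close>; the eigenvalue of FE is \<open>ucoef l (m + 2)\<close>.\<close>

definition ucoef :: "complex \<Rightarrow> complex \<Rightarrow> complex" where
  "ucoef l m = (l - m\<^sup>2 / 2 + m) / 2"

text \<open>Weight modules on functions of the weight \<open>m\<close>: \<open>E\<close> shifts weights by 2 and the coefficients
  of \<open>F\<close> are forced by requiring the Casimir element to act as the scalar \<open>l\<close>.\<close>
fun urep :: "complex \<Rightarrow> ugen \<Rightarrow> (complex \<Rightarrow> complex) \<Rightarrow> complex \<Rightarrow> complex" where
  "urep l GE f = (\<lambda>m. f (m - 2))"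
| "urep l GF f = (\<lambda>m. ucoef l (m + 2) * f (m + 2))"
| "urep l GH f = (\<lambda>m. m * f m)"

lemma linop_urep: "linop (urep l x)"
  by (cases x) (auto simp: linop_def algebra_simps)

lemma RelU_ncpolys: "RelU \<subseteq> ncpolys"
  by (auto simp: RelU_def)

lemma RelU_annihilated: "g \<in> RelU \<Longrightarrow> act (urep l) g f = (\<lambda>m. 0)"
  by (auto simp: RelU_def nccomm_def act_simps linop_urep ucoef_def power2_eq_square field_simps)

section \<open>PBW monomials of U(sl2): straightening\<close>

fun nc_power :: "'v ncp \<Rightarrow> nat \<Rightarrow> 'v ncp" where
  "nc_power p 0 = ncconst 1"
| "nc_power p (Suc n) = p \<otimes> nc_power p n"

lemma ncpolys_power [simp]: "p \<in> ncpolys \<Longrightarrow> nc_power p n \<in> ncpolys"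
  by (induction n) auto

lemma nc_power_Suc2: "nc_power p (Suc n) = nc_power p n \<otimes> p"
proof (induction n)
  case (Suc n)
  then show ?case by (metis ncmul_assoc nc_power.simps(2))
qed (simp add: ncconst_mul mul_ncconst)

lemma act_power:
  assumes "p \<in> ncpolys" "\<And>x. linop (\<rho> x)"
  shows "act \<rho> (nc_power p n) f = (act \<rho> p ^^ n) f"
  by (induction n) (auto simp: act_const act_mul assms)

text \<open>H stands rightmost so that on a weight vector it contributes only the scalar
  \<open>m ^ c\<close>.\<close>

fun upbw :: "nat \<times> nat \<times> nat \<Rightarrow> ugen ncp" where
  "upbw (a, b, c) = nc_power uE a \<otimes> (nc_power uF b \<otimes> nc_power uH c)"

lemma upbw_ncpolys: "upbw t \<in> ncpolys"
  by (cases t) simp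

lemma upbw_Suc: "uE \<otimes> upbw (a, b, c) = upbw (Suc a, b, c)"
  by (simp add: ncmul_assoc)

text \<open>Each F lowers the weight by 2, so carrying H to the right past \<open>b\<close> of them
  costs \<open>2 * b\<close>.\<close>

lemma uH_upbw0:
  "uH \<otimes> upbw (0, b, c) \<ominus> (upbw (0, b, Suc c) \<ominus> (2 * of_nat b) \<odot> upbw (0, b, c)) \<in> nc_ideal RelU"
proof (induction b)
  case 0
  have "uH \<otimes> upbw (0, 0, c) \<ominus> (upbw (0, 0, Suc c) \<ominus> (2 * of_nat 0) \<odot> upbw (0, 0, c)) = ncconst 0"
    by (rule ext) (simp add: nc_ring_simps nc_pointwise, simp add: ncconst_def)
  then show ?case by (simp add: nc_ideal.zero)
next
  case (Suc b)
  define m where "m = nc_power uF b \<otimes> nc_power uH c"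
  define m' where "m' = nc_power uF b \<otimes> nc_power uH (Suc c)"
  let ?r = "nccomm uH uF \<oplus> 2 \<odot> uF"
  have r: "?r \<in> nc_ideal RelU" by (auto simp: RelU_def intro: nc_ideal.gen)
  have one: "ncconst 1 \<otimes> p = p" for p :: "ugen ncp" by (simp add: ncconst_mul ncscale_def)
  have IH: "uH \<otimes> m \<ominus> (m' \<ominus> (2 * of_nat b) \<odot> m) \<in> nc_ideal RelU"
    using Suc unfolding m_def m'_def upbw.simps by (simp add: one)
  have "uH \<otimes> (uF \<otimes> m) \<ominus> (uF \<otimes> m' \<ominus> (2 * of_nat (Suc b)) \<odot> (uF \<otimes> m))
      = ?r \<otimes> m \<oplus> uF \<otimes> (uH \<otimes> m \<ominus> (m' \<ominus> (2 * of_nat b) \<odot> m))"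
    by (rule ext) (simp add: nccomm_def nc_ring_simps nc_apply algebra_simps)
  also have "\<dots> \<in> nc_ideal RelU"
    by (intro nc_ideal_intros r IH) (auto simp: m_def)
  finally show ?case unfolding m_def m'_def upbw.simps nc_power.simps one ncmul_assoc .
qed

text \<open>F and H are treated together because FE = EF - H: moving F past E produces an H that
  still has to be moved.\<close>

lemma u_upbw_in_span:
  "uF \<otimes> upbw (a, b, c) \<in> span_mod RelU upbw \<and> uH \<otimes> upbw (a, b, c) \<in> span_mod RelU upbw"
proof (induction a)
  case 0
  have "uF \<otimes> upbw (0, b, c) = upbw (0, Suc b, c)"
    by (rule ext) (simp add: nc_ring_simps nc_pointwise)
  then have "uF \<otimes> upbw (0, b, c) \<in> span_mod RelU upbw" using span_mod_gen by metis
  moreover have "uH \<otimes> upbw (0, b, c) \<in> span_mod RelU upbw"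
    by (rule span_mod_cong[OF _ uH_upbw0]) (intro span_mod_sub span_mod_scale span_mod_gen)
  ultimately show ?case by simp
next
  case (Suc a)
  define m where "m = upbw (a, b, c)"
  have m: "m \<in> ncpolys" by (simp add: m_def)
  have E: "uE \<otimes> p \<in> span_mod RelU upbw" if "p \<in> span_mod RelU upbw" for p
    using that
  proof (rule span_mod_lmul)
    show "uE \<otimes> upbw t \<in> span_mod RelU upbw" for t
      by (cases t) (metis upbw_Suc span_mod_gen)
  qed simp
  have gens: "nccomm uH uE \<ominus> 2 \<odot> uE \<in> nc_ideal RelU" "nccomm uE uF \<ominus> uH \<in> nc_ideal RelU"
    by (auto simp: RelU_def intro: nc_ideal.gen)
  have "uF \<otimes> (uE \<otimes> m) \<ominus> (uE \<otimes> (uF \<otimes> m) \<ominus> uH \<otimes> m) = (-1) \<odot> ((nccomm uE uF \<ominus> uH) \<otimes> m)"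
    "uH \<otimes> (uE \<otimes> m) \<ominus> (uE \<otimes> (uH \<otimes> m) \<oplus> 2 \<odot> (uE \<otimes> m)) = (nccomm uH uE \<ominus> 2 \<odot> uE) \<otimes> m"
    by (rule ext, simp add: nccomm_def nc_ring_simps nc_apply algebra_simps)+
  then have 1: "uF \<otimes> (uE \<otimes> m) \<ominus> (uE \<otimes> (uF \<otimes> m) \<ominus> uH \<otimes> m) \<in> nc_ideal RelU"
    and 2: "uH \<otimes> (uE \<otimes> m) \<ominus> (uE \<otimes> (uH \<otimes> m) \<oplus> 2 \<odot> (uE \<otimes> m)) \<in> nc_ideal RelU"
    using nc_ideal_intros gens m by metis+
  show ?case
    unfolding upbw_Suc[symmetric] m_def[symmetric]
    using Suc span_mod_gen[of upbw "(a, b, c)" RelU]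
    by (intro conjI span_mod_cong[OF _ 1] span_mod_cong[OF _ 2] span_mod_sub span_mod_add
        span_mod_scale E) (simp_all add: m_def del: upbw.simps)
qed

lemma ncpolys_subset_span_upbw:
  assumes "p \<in> ncpolys" shows "p \<in> span_mod RelU upbw"
proof (rule ncpolys_subset_span_mod[OF _ _ assms])
  have "ncconst 1 = upbw (0, 0, 0)" by (simp add: ncconst_mul)
  then show "ncconst 1 \<in> span_mod RelU upbw" using span_mod_gen by metis
  show "ncvar x \<otimes> upbw t \<in> span_mod RelU upbw" for x t
    by (cases t; cases x) (simp_all only: u_upbw_in_span upbw_Suc span_mod_gen)
qed

section \<open>Independence of the PBW monomials on weight vectors\<close>

definition unit_at :: "complex \<Rightarrow> complex \<Rightarrow> complex" where
  "unit_at m = (\<lambda>n. if n = m then 1 else 0)"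

lemma act_upbw_unit_at:
  "act (urep l) (upbw (a, b, c)) (unit_at m)
    = (\<lambda>n. m ^ c * (\<Prod>t<b. ucoef l (m - 2 * of_nat t)) * unit_at (m + 2 * of_nat a - 2 * of_nat b) n)"
proof -
  have H: "(act (urep l) uH ^^ c) (unit_at m) = (\<lambda>n. m ^ c * unit_at m n)"
    by (induction c) (auto simp: act_var unit_at_def)
  have F: "(act (urep l) uF ^^ b) (\<lambda>n. x * unit_at m n)
      = (\<lambda>n. x * (\<Prod>t<b. ucoef l (m - 2 * of_nat t)) * unit_at (m - 2 * of_nat b) n)" for x
  proof (induction b)
    case (Suc b)
    show ?case
      unfolding funpow.simps o_apply Suc by (rule ext) (auto simp: act_var unit_at_def algebra_simps)
  qed simp
  have E: "(act (urep l) uE ^^ a) (\<lambda>n. x * unit_at k n) = (\<lambda>n. x * unit_at (k + 2 * of_nat a) n)" for x k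
  proof (induction a)
    case (Suc a)
    show ?case
      unfolding funpow.simps o_apply Suc by (rule ext) (auto simp: act_var unit_at_def algebra_simps)
  qed simp
  show ?thesis
    by (simp add: act_mul act_power linop_urep H F E) (simp add: algebra_simps)
qed

lemma polyfun_infinite_roots:
  fixes c :: "nat \<Rightarrow> complex"
  assumes "infinite X" "\<And>x. x \<in> X \<Longrightarrow> (\<Sum>i\<le>n. c i * x ^ i) = 0" "i \<le> n"
  shows "c i = 0"
proof (rule ccontr)
  assume "c i \<noteq> 0"
  then have "finite {x. (\<Sum>i\<le>n. c i * x ^ i) = 0}" using assms(3) by (auto simp: polyfun_finite_roots)
  then show False using assms(1,2) by (metis (mono_tags, lifting) mem_Collect_eq finite_subset subsetI)
qed

text \<open>Among the monomials that shift weights by \<open>2(a - b)\<close>, take one with minimal \<open>b\<close>: choosing \<open>l\<close>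
  so that \<open>F\<close> kills weight \<open>m - 2b\<close> removes all those with larger \<open>b\<close>.\<close>
lemma upbw_independent:
  assumes fin: "finite {t. c t \<noteq> 0}"
    and zero: "\<And>l f s. (\<Sum>t | c t \<noteq> 0. c t * act (urep l) (upbw t) f s) = 0"
  shows "{t. c t \<noteq> 0} = {}"
proof (rule ccontr)
  assume "{t. c t \<noteq> 0} \<noteq> {}"
  then obtain a1 b1 c1 where t1: "c (a1, b1, c1) \<noteq> 0" by auto
  define k where "k = int a1 - int b1"
  let ?Q = "\<lambda>b. \<exists>a d. c (a, b, d) \<noteq> 0 \<and> int a - int b = k"
  define b0 where "b0 = (LEAST b. ?Q b)"
  have "?Q b0" unfolding b0_def by (rule LeastI[of ?Q b1]) (use t1 k_def in blast)
  then obtain a0 c0 where t0: "c (a0, b0, c0) \<noteq> 0" "int a0 - int b0 = k" by blast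
  have least: "b0 \<le> b" if "c (a, b, d) \<noteq> 0" "int a - int b = k" for a b d
    unfolding b0_def by (rule Least_le) (use that in blast)
  define N where "N = Max ((\<lambda>(a, b, d). d) ` {t. c t \<noteq> 0})"
  have N: "d \<le> N" if "c (a, b, d) \<noteq> 0" for a b d
    unfolding N_def by (rule Max_ge) (use fin that in force)+
  \<comment> \<open>The removed values of \<open>m\<close> are those for which F would already kill
    a weight above \<open>m - 2 * b0\<close>, making the product \<open>P b0\<close> vanish.\<close>
  define X where "X = (UNIV :: complex set) - (\<lambda>t. of_nat b0 + of_nat t + 1) ` {..<b0}"
  have "infinite X" unfolding X_def by (simp add: infinite_UNIV_char_0)
  moreover have "(\<Sum>d\<le>N. c (a0, b0, d) * m ^ d) = 0" if "m \<in> X" for m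
  proof -
    define x where "x = m - 2 * of_nat b0"
    define l where "l = x\<^sup>2 / 2 - x"
    define P where "P b = (\<Prod>t<b. ucoef l (m - 2 * of_nat t))" for b
    \<comment> \<open>As a quadratic in the weight, \<open>ucoef l\<close> has the roots
      \<open>x\<close> and \<open>2 - x\<close>. The first gives the factor that vanishes at
      \<open>t = b0\<close>, the second the values excluded from \<open>X\<close>.\<close>
    have uc: "ucoef l (m - 2 * of_nat t) = (of_nat t - of_nat b0) * (m - (of_nat b0 + of_nat t + 1))" for t
      by (simp add: ucoef_def l_def x_def power2_eq_square field_simps)
    have P0: "P b0 \<noteq> 0"
      using that unfolding P_def by (auto simp: uc X_def)
    have Pbig: "P b = 0" if "b0 < b" for b
      using that unfolding P_def by (auto simp: uc intro!: prod_zero bexI[of _ b0])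
    let ?s = "m + 2 * of_nat a0 - 2 * of_nat b0"
    let ?S = "{t. c t \<noteq> 0}" and ?T = "(\<lambda>d. (a0, b0, d)) ` {..N}"
    have val: "c (a, b, d) * act (urep l) (upbw (a, b, d)) (unit_at m) ?s =
        (if a = a0 \<and> b = b0 then c (a0, b0, d) * m ^ d * P b0 else 0)" for a b d
    proof (cases "c (a, b, d) = 0 \<or> (a = a0 \<and> b = b0)")
      case True
      then show ?thesis
        by (auto simp: act_upbw_unit_at P_def simp del: upbw.simps) (simp_all add: unit_at_def)
    next
      case False
      have "P b * unit_at (m + 2 * of_nat a - 2 * of_nat b) ?s = 0"
      proof (cases "int a - int b = k")
        case True
        then have "b0 < b" using False least[of a b d] t0(2) by force
        then show ?thesis by (simp add: Pbig)
      next
        case False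
        have "m + 2 * of_nat a - 2 * of_nat b \<noteq> ?s"
        proof
          assume "m + 2 * of_nat a - 2 * of_nat b = ?s"
          then have "of_nat a + of_nat b0 = (of_nat a0 + of_nat b :: complex)"
            by (simp add: field_simps) algebra
          then have "a + b0 = a0 + b" by (metis of_nat_add of_nat_eq_iff)
          then show False using False t0(2) by linarith
        qed
        then show ?thesis by (auto simp: unit_at_def)
      qed
      then have "act (urep l) (upbw (a, b, d)) (unit_at m) ?s = 0"
        by (simp only: act_upbw_unit_at P_def[symmetric] mult.assoc) simp
      then show ?thesis using False by auto
    qed
    have "0 = (\<Sum>t\<in>?S. c t * act (urep l) (upbw t) (unit_at m) ?s)" using zero by simp
    also have "\<dots> = (\<Sum>t\<in>?S \<union> ?T. c t * act (urep l) (upbw t) (unit_at m) ?s)"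
      using fin by (intro sum.mono_neutral_left) auto
    also have "\<dots> = (\<Sum>t\<in>?T. c t * act (urep l) (upbw t) (unit_at m) ?s)"
    proof (intro sum.mono_neutral_right ballI)
      fix t assume "t \<in> ?S \<union> ?T - ?T"
      then obtain a b d where "t = (a, b, d)" "\<not> (a = a0 \<and> b = b0)"
        using N by (cases t) (auto simp: image_iff)
      then show "c t * act (urep l) (upbw t) (unit_at m) ?s = 0"
        using val by metis
    qed (use fin in auto)
    also have "\<dots> = (\<Sum>d\<le>N. c (a0, b0, d) * m ^ d) * P b0"
      by (subst sum.reindex) (auto simp: inj_on_def val sum_distrib_right simp del: upbw.simps)
    finally show ?thesis using P0 by simp
  qed
  ultimately have "c (a0, b0, c0) = 0"
    using polyfun_infinite_roots[where X = X and n = N and c = "\<lambda>d. c (a0, b0, d)" and i = c0] N[OF t0(1)] by blast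
  then show False using t0 by simp
qed

theorem nc_ideal_RelU_iff:
  assumes "p \<in> ncpolys"
  shows "p \<in> nc_ideal RelU \<longleftrightarrow> (\<forall>l f. act (urep l) p f = (\<lambda>m. 0))"
proof
  assume "p \<in> nc_ideal RelU"
  then show "\<forall>l f. act (urep l) p f = (\<lambda>m. 0)"
    using nc_ideal_annihilated RelU_ncpolys linop_urep RelU_annihilated by metis
next
  assume "\<forall>l f. act (urep l) p f = (\<lambda>m. 0)"
  then show "p \<in> nc_ideal RelU"
    by (intro nc_ideal_if_annihilated[where g = upbw and \<rho> = urep, OF RelU_ncpolys linop_urep
        RelU_annihilated upbw_ncpolys assms ncpolys_subset_span_upbw[OF assms] _ upbw_independent]) auto
qed

section \<open>The kernel contains the three elements\<close>

lemma sharp_gen_ncpolys: "sharp_gen x \<in> ncpolys"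
  by (cases x) simp_all

definition rrep :: "complex \<Rightarrow> rgen \<Rightarrow> (complex \<Rightarrow> complex) \<Rightarrow> complex \<Rightarrow> complex" where
  "rrep l x = act (urep l) (sharp_gen x)"

lemma linop_rrep: "linop (rrep l x)"
  unfolding rrep_def by (rule linop_act[OF linop_urep])

text \<open>The coefficient with which F^2 maps weight \<open>m + 4\<close> to weight
  \<open>m\<close>.\<close>

definition uquad :: "complex \<Rightarrow> complex \<Rightarrow> complex" where
  "uquad l m = ucoef l (m + 2) * ucoef l (m + 4)"

lemma rrep_simps:
  "rrep l GA f = (\<lambda>m. (f (m - 4) + (l - m\<^sup>2 / 2 - 4) * f m + uquad l m * f (m + 4)) / 16)"
  "rrep l GB f = (\<lambda>m. (m\<^sup>2 - 4) / 16 * f m)"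
  "rrep l GC f = (\<lambda>m. (- f (m - 4) + (l - m\<^sup>2 / 2 - 4) * f m - uquad l m * f (m + 4)) / 16)"
  "rrep l GD f = (\<lambda>m. ((m + 2) * uquad l m * f (m + 4) - (m - 2) * f (m - 4)) / 64)"
proof -
  have i: "\<i> * (\<i> * z) = - z" for z by (simp flip: mult.assoc)
  \<comment> \<open>The two summands are the eigenvalues of EF and FE. Their sum is the diagonal
    part of (E + F)^2 and also of (iE - iF)^2, the remaining parts being E^2 + F^2 and its
    negative.\<close>
  have q: "l - m\<^sup>2 / 2 = ucoef l m + ucoef l (m + 2)" for m
    by (simp add: ucoef_def field_simps power2_eq_square)
  show
    "rrep l GA f = (\<lambda>m. (f (m - 4) + (l - m\<^sup>2 / 2 - 4) * f m + uquad l m * f (m + 4)) / 16)"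
    "rrep l GB f = (\<lambda>m. (m\<^sup>2 - 4) / 16 * f m)"
    "rrep l GC f = (\<lambda>m. (- f (m - 4) + (l - m\<^sup>2 / 2 - 4) * f m - uquad l m * f (m + 4)) / 16)"
    "rrep l GD f = (\<lambda>m. ((m + 2) * uquad l m * f (m + 4) - (m - 2) * f (m - 4)) / 64)"
    unfolding rrep_def sharp_gen.simps q uquad_def
    by (rule ext, simp add: act_simps linop_urep algebra_simps power2_eq_square i)+
qed

lemma r_ncpolys [simp]:
  "ralpha \<in> ncpolys" "rbeta \<in> ncpolys" "rgamma \<in> ncpolys" "rdelta \<in> ncpolys"
  "OmegaA \<in> ncpolys" "OmegaB \<in> ncpolys" "OmegaC \<in> ncpolys"
  by (simp_all add: ralpha_def rbeta_def rgamma_def rdelta_def OmegaA_def OmegaB_def OmegaC_def)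

lemma third_gen_ncpolys [simp]: "p \<in> ncpolys \<Longrightarrow> third_gen p \<in> ncpolys"
  by (simp add: third_gen_def)

lemma RelR_ncpolys: "RelR \<subseteq> ncpolys"
  by (auto simp: RelR_def)

text \<open>The shifts in A and C cancel, and EF + FE joins with the H^2 in B to the Casimir element
  of U(sl2).\<close>

lemma act_rrep_rdelta: "act (rrep l) rdelta f = (\<lambda>m. (l / 8 - 3 / 4) * f m)"
  by (rule ext, simp add: rdelta_def act_simps linop_rrep rrep_simps field_simps power2_eq_square)

lemma act_rrep_ralpha: "act (rrep l) ralpha f = (\<lambda>m. 0)"
  by (rule ext, simp add: ralpha_def nccomm_def act_simps linop_rrep rrep_simps field_simps power2_eq_square)
     (simp add: uquad_def ucoef_def field_simps power2_eq_square)

lemma act_rrep_rbeta: "act (rrep l) rbeta f = (\<lambda>m. 0)"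
  by (rule ext, simp add: rbeta_def nccomm_def act_simps linop_rrep rrep_simps field_simps power2_eq_square)

lemma act_rrep_rgamma: "act (rrep l) rgamma f = (\<lambda>m. 0)"
  by (rule ext, simp add: rgamma_def nccomm_def act_simps linop_rrep rrep_simps field_simps power2_eq_square)
     (simp add: uquad_def ucoef_def field_simps power2_eq_square)

lemma act_rrep_comm:
  "act (rrep l) (nccomm rA rB \<ominus> 2 \<odot> rD) f = (\<lambda>m. 0)"
  "act (rrep l) (nccomm rB rC \<ominus> 2 \<odot> rD) f = (\<lambda>m. 0)"
  "act (rrep l) (nccomm rC rA \<ominus> 2 \<odot> rD) f = (\<lambda>m. 0)"
  by (rule ext, simp add: nccomm_def act_simps linop_rrep rrep_simps field_simps power2_eq_square;
     simp add: uquad_def ucoef_def field_simps power2_eq_square)+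

lemma act_rrep_RelR: "g \<in> RelR \<Longrightarrow> act (rrep l) g f = (\<lambda>m. 0)"
proof -
  have "act (rrep l) (nccomm z (ncvar x)) f = (\<lambda>m. 0)"
    if "z \<in> {ralpha, rbeta, rgamma}" for z x
  proof -
    have z: "z \<in> ncpolys" "\<And>f. act (rrep l) z f = (\<lambda>m. 0)"
      using that act_rrep_ralpha act_rrep_rbeta act_rrep_rgamma by auto
    then show ?thesis
      by (simp add: nccomm_def act_simps linop_rrep) (simp add: linop_zero linop_rrep)
  qed
  then show "g \<in> RelR \<Longrightarrow> ?thesis" unfolding RelR_def using act_rrep_comm by auto
qed

lemma act_rrep_third_OmegaA: "act (rrep l) (third_gen OmegaA) f = (\<lambda>m. 0)"
proof
  fix m
  have *: "act (rrep l) OmegaA f m = - 3 / 256 * (l / 2 - 6) * (l / 2 - 2) * f m"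
    unfolding OmegaA_def
    by (simp add: act_simps linop_rrep act_rrep_rbeta act_rrep_rgamma act_rrep_rdelta linop_zero)
       (simp add: rrep_simps field_simps power2_eq_square,
        simp add: uquad_def ucoef_def field_simps power2_eq_square)
  show "act (rrep l) (third_gen OmegaA) f m = 0"
    unfolding third_gen_def
    by (simp add: act_simps linop_rrep act_rrep_rdelta * field_simps)
qed

section \<open>Normal forms modulo the three elements\<close>

abbreviation "relAB \<equiv> nccomm rA rB \<ominus> 2 \<odot> rD"
abbreviation "relBC \<equiv> nccomm rB rC \<ominus> 2 \<odot> rD"
abbreviation "relCA \<equiv> nccomm rC rA \<ominus> 2 \<odot> rD"

text \<open>C is eliminated as \<delta> - A - B. B and \<delta> stand on the right because they act
  on a weight vector as scalars, which leaves only A and \<Delta> to move it.\<close>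

fun rmon :: "nat \<times> bool \<times> nat \<times> nat \<Rightarrow> rgen ncp" where
  "rmon (i, j, k, s)
    = nc_power rA i \<otimes> ((if j then rD else ncconst 1) \<otimes> (nc_power rB k \<otimes> nc_power rdelta s))"

lemma rmon_ncpolys: "rmon t \<in> ncpolys"
  by (cases t) simp

lemma rmon_Suc:
  "rA \<otimes> rmon (i, j, k, s) = rmon (Suc i, j, k, s)"
  "rB \<otimes> rmon (0, False, k, s) = rmon (0, False, Suc k, s)"
  "rD \<otimes> rmon (0, False, k, s) = rmon (0, True, k, s)"
  "rmon (i, j, k, s) \<otimes> rdelta = rmon (i, j, k, Suc s)"
  by (simp_all add: ncmul_assoc ncconst_mul nc_power_Suc2[symmetric] del: nc_power.simps)
     (simp_all add: ncmul_assoc ncconst_mul)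

text \<open>\<open>G\<close> is left open because both choices occur: with \<alpha> and \<beta>
  alone for comparing the Casimir elements, and with the third element added for the normal
  forms.\<close>

context
  fixes G
  assumes G: "RelR \<union> {ralpha, rbeta} \<subseteq> G"
begin

lemma in_ideal [simp, intro]:
  "relAB \<in> nc_ideal G" "relBC \<in> nc_ideal G" "relCA \<in> nc_ideal G"
  "ralpha \<in> nc_ideal G" "rbeta \<in> nc_ideal G"
  using G by (auto simp: RelR_def intro!: nc_ideal.gen)

lemma rdelta_central:
  assumes "p \<in> ncpolys" shows "nccomm rdelta p \<in> nc_ideal G"
proof -
  have A: "nccomm rdelta rA = relCA \<ominus> relAB"
    and B: "nccomm rdelta rB = relAB \<ominus> relBC"
    and C: "nccomm rdelta rC = relBC \<ominus> relCA"
    by (rule ext, simp add: rdelta_def nccomm_def nc_ring_simps nc_apply)+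
  \<comment> \<open>Commutation with \<delta> is a derivation. It kills A and B modulo the ideal,
    hence also \<Delta>, which is half of [A, B] there.\<close>
  have D: "nccomm rdelta rD = (1/2) \<odot> (nccomm (nccomm rdelta rA) rB \<oplus> nccomm rA (nccomm rdelta rB))
      \<ominus> (1/2) \<odot> nccomm rdelta relAB"
    by (rule ext) (simp add: nccomm_def nc_ring_simps nc_apply algebra_simps)
  have comm: "nccomm a q \<in> nc_ideal G" "nccomm q a \<in> nc_ideal G"
    if "a \<in> nc_ideal G" "q \<in> ncpolys" for a q
    using that unfolding nccomm_def by (auto intro: nc_ideal_intros)
  have AB: "nccomm rdelta rA \<in> nc_ideal G" "nccomm rdelta rB \<in> nc_ideal G" "nccomm rdelta rC \<in> nc_ideal G"
    unfolding A B C by (auto intro: nc_ideal_sub)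
  have var: "nccomm rdelta (ncvar x) \<in> nc_ideal G" for x
  proof (cases x)
    case GD
    show ?thesis unfolding GD D
      by (intro nc_ideal_sub nc_ideal.add nc_ideal_scale comm(1)[OF AB(1)] comm(2)[OF AB(2)]
          comm(2)[OF in_ideal(1)]) auto
  qed (use AB in auto)
  show ?thesis using assms
  proof (induction p rule: ncpolys_induct)
    case one
    have "nccomm rdelta (ncconst 1) = ncconst 0"
      by (rule ext) (simp add: nccomm_def nc_ring_simps nc_apply, simp add: ncconst_def)
    then show ?case by (simp add: nc_ideal.zero)
  next
    case (var x p)
    have "nccomm rdelta (ncvar x \<otimes> p) = nccomm rdelta (ncvar x) \<otimes> p \<oplus> ncvar x \<otimes> nccomm rdelta p"
      by (rule ext) (simp add: nccomm_def nc_ring_simps nc_apply)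
    then show ?case using var \<open>\<And>x. nccomm rdelta (ncvar x) \<in> nc_ideal G\<close>
      by (simp add: nc_ideal.add nc_ideal_lmul nc_ideal_rmul)
  next
    case (add p q)
    have "nccomm rdelta (p \<oplus> q) = nccomm rdelta p \<oplus> nccomm rdelta q"
      by (rule ext) (simp add: nccomm_def nc_ring_simps nc_apply)
    then show ?case using add by (auto intro: nc_ideal_intros)
  next
    case (scale c p)
    have "nccomm rdelta (c \<odot> p) = c \<odot> nccomm rdelta p"
      by (rule ext) (simp add: nccomm_def nc_ring_simps nc_apply algebra_simps)
    then show ?case using scale by (auto intro: nc_ideal_intros)
  qed
qed

text \<open>The quadratic terms of \<alpha> + \<beta> + \<gamma> telescope, leaving
  [\<delta>, \<Delta>].\<close>

lemma rgamma_in_ideal [simp, intro]: "rgamma \<in> nc_ideal G"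
proof -
  have "rgamma = nccomm rdelta rD \<ominus> ralpha \<ominus> rbeta"
    by (rule ext) (simp add: rdelta_def ralpha_def rbeta_def rgamma_def nccomm_def nc_ring_simps nc_apply)
  also have "\<dots> \<in> nc_ideal G" by (intro nc_ideal_sub rdelta_central in_ideal) simp
  finally show ?thesis .
qed

text \<open>In \<Re> the differences are (1 + \<delta>)\<gamma> and (1 + \<delta>)\<alpha>, by
  \<alpha> + \<beta> + \<gamma> = 0; the identities below also record the multiples of the defining
  relations.\<close>

lemma Omega_diff_in_ideal: "OmegaA \<ominus> OmegaB \<in> nc_ideal G" "OmegaB \<ominus> OmegaC \<in> nc_ideal G"
proof -
  have "OmegaA \<ominus> OmegaB = (1/2) \<odot> nccomm rC relAB \<oplus> rgamma \<oplus> relBC \<ominus> relAB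
      \<oplus> rB \<otimes> rgamma \<ominus> rC \<otimes> rbeta \<ominus> rC \<otimes> ralpha \<oplus> rA \<otimes> rgamma"
    by (rule ext) (simp add: OmegaA_def OmegaB_def ralpha_def rbeta_def rgamma_def rdelta_def
      nccomm_def nc_ring_simps nc_apply algebra_simps)
  also have "\<dots> \<in> nc_ideal G" unfolding nccomm_def[of rC]
    by (intro nc_ideal_intros in_ideal rgamma_in_ideal) auto
  finally show "OmegaA \<ominus> OmegaB \<in> nc_ideal G" .
  have "OmegaB \<ominus> OmegaC = (1/2) \<odot> nccomm rA relBC \<oplus> ralpha \<oplus> relCA \<ominus> relBC
      \<oplus> rC \<otimes> ralpha \<ominus> rA \<otimes> rgamma \<ominus> rA \<otimes> rbeta \<oplus> rB \<otimes> ralpha"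
    by (rule ext) (simp add: OmegaB_def OmegaC_def ralpha_def rbeta_def rgamma_def rdelta_def
      nccomm_def nc_ring_simps nc_apply algebra_simps)
  also have "\<dots> \<in> nc_ideal G" unfolding nccomm_def[of rA relBC]
    by (intro nc_ideal_intros in_ideal rgamma_in_ideal) auto
  finally show "OmegaB \<ominus> OmegaC \<in> nc_ideal G" .
qed

lemma third_gen_diff_in_ideal:
  assumes "\<Omega> \<in> {OmegaA, OmegaB, OmegaC}"
  shows "third_gen OmegaA \<ominus> third_gen \<Omega> \<in> nc_ideal G"
proof -
  have "OmegaA \<ominus> \<Omega> \<in> nc_ideal G"
  proof -
    have "OmegaA \<ominus> OmegaA = ncconst 0" "OmegaA \<ominus> OmegaC = (OmegaA \<ominus> OmegaB) \<oplus> (OmegaB \<ominus> OmegaC)"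
      by (simp_all add: nc_pointwise ncconst_def)
    then show ?thesis
      using assms Omega_diff_in_ideal nc_ideal.zero[of G] nc_ideal.add by auto
  qed
  moreover have "third_gen OmegaA \<ominus> third_gen \<Omega> = 256 \<odot> (OmegaA \<ominus> \<Omega>)"
    by (rule ext) (simp add: third_gen_def nc_apply algebra_simps)
  ultimately show ?thesis by (simp add: nc_ideal_scale)
qed

section \<open>Reduction of products to the normal forms\<close>

lemma rA_span: "p \<in> span_mod G rmon \<Longrightarrow> rA \<otimes> p \<in> span_mod G rmon"
proof (erule span_mod_lmul)
  show "rA \<otimes> rmon t \<in> span_mod G rmon" for t
    by (cases t) (simp only: rmon_Suc span_mod_gen)
qed simp

lemma rdelta_span: "p \<in> span_mod G rmon \<Longrightarrow> rdelta \<otimes> p \<in> span_mod G rmon"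
proof (erule span_mod_lmul)
  fix t
  have "rmon t \<otimes> rdelta \<in> span_mod G rmon"
    by (cases t) (simp only: rmon_Suc span_mod_gen)
  then show "rdelta \<otimes> rmon t \<in> span_mod G rmon"
    using rdelta_central[OF rmon_ncpolys[of t]] unfolding nccomm_def by (rule span_mod_cong)
qed simp

lemma rC_conv: "rC \<otimes> m = rdelta \<otimes> m \<ominus> rA \<otimes> m \<ominus> rB \<otimes> m"
  by (rule ext) (simp add: rdelta_def nc_ring_simps nc_apply)

text \<open>Modulo the ideal BA = AB - 2\<Delta>, and \<alpha> gives \<Delta>A = A\<Delta> + AC -
  BA. The second rewriting uses the result of the first, so the two are proved together.\<close>

lemma rBD_rA_span:
  assumes m: "m \<in> ncpolys" "m \<in> span_mod G rmon"
    and B: "rB \<otimes> m \<in> span_mod G rmon" and D: "rD \<otimes> m \<in> span_mod G rmon"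
  shows "rB \<otimes> (rA \<otimes> m) \<in> span_mod G rmon \<and> rD \<otimes> (rA \<otimes> m) \<in> span_mod G rmon"
proof
  have "rB \<otimes> (rA \<otimes> m) \<ominus> (rA \<otimes> (rB \<otimes> m) \<ominus> 2 \<odot> (rD \<otimes> m)) = (-1) \<odot> (relAB \<otimes> m)"
    by (rule ext) (simp add: nccomm_def nc_ring_simps nc_apply algebra_simps)
  then have "rB \<otimes> (rA \<otimes> m) \<ominus> (rA \<otimes> (rB \<otimes> m) \<ominus> 2 \<odot> (rD \<otimes> m)) \<in> nc_ideal G"
    using m by (auto intro: nc_ideal_intros)
  then show BA: "rB \<otimes> (rA \<otimes> m) \<in> span_mod G rmon"
    by (rule span_mod_cong[rotated]) (intro span_mod_sub span_mod_scale rA_span B D)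
  let ?q = "rA \<otimes> (rD \<otimes> m) \<oplus> rA \<otimes> (rC \<otimes> m) \<ominus> rB \<otimes> (rA \<otimes> m)"
  have "rD \<otimes> (rA \<otimes> m) \<ominus> ?q = (-1) \<odot> (ralpha \<otimes> m)"
    by (rule ext) (simp add: ralpha_def nccomm_def nc_ring_simps nc_apply algebra_simps)
  then have "rD \<otimes> (rA \<otimes> m) \<ominus> ?q \<in> nc_ideal G"
    using m by (auto intro: nc_ideal_intros)
  then show "rD \<otimes> (rA \<otimes> m) \<in> span_mod G rmon"
    by (rule span_mod_cong[rotated], unfold rC_conv)
       (intro span_mod_sub span_mod_add rA_span rdelta_span BA B D m)
qed

lemma rBD_rmon_False:
  "rB \<otimes> rmon (i, False, k, s) \<in> span_mod G rmon \<and> rD \<otimes> rmon (i, False, k, s) \<in> span_mod G rmon"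
proof (induction i)
  case 0
  show ?case by (simp only: rmon_Suc span_mod_gen simp_thms)
next
  case (Suc i)
  then show ?case
    unfolding rmon_Suc(1)[symmetric] using rBD_rA_span[OF rmon_ncpolys span_mod_gen] by blast
qed

context
  assumes third: "third_gen OmegaA \<in> nc_ideal G"
begin

text \<open>The third element is solved for \<Delta>^2. Replacing C by \<delta> - A - B in BAC and
  CAB leaves B in front of exactly the listed products; for \<open>m\<close> free of \<Delta> these
  are settled by \<open>rBD_rmon_False\<close>.\<close>

lemma rD_rD_span:
  assumes m: "m \<in> ncpolys" "m \<in> span_mod G rmon"
    and B: "\<And>p. p \<in> {m, rA \<otimes> m, rA \<otimes> (rA \<otimes> m), rA \<otimes> (rB \<otimes> m), rA \<otimes> (m \<otimes> rdelta)} \<Longrightarrow> rB \<otimes> p \<in> span_mod G rmon"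
  shows "rD \<otimes> (rD \<otimes> m) \<in> span_mod G rmon"
proof -
  \<comment> \<open>\<delta> is moved behind \<open>m\<close> because the monomials carry it at
    their right end.\<close>
  have "rB \<otimes> (rA \<otimes> (rdelta \<otimes> m)) \<ominus> rB \<otimes> (rA \<otimes> (m \<otimes> rdelta)) = rB \<otimes> (rA \<otimes> nccomm rdelta m)"
    by (simp add: nccomm_def ncmul_distribs)
  also have "\<dots> \<in> nc_ideal G"
    using m by (intro nc_ideal_lmul rdelta_central) auto
  finally have "rB \<otimes> (rA \<otimes> (rdelta \<otimes> m)) \<in> span_mod G rmon"
    by (rule span_mod_cong[rotated]) (simp add: B)
  then have BAC: "rB \<otimes> (rA \<otimes> (rC \<otimes> m)) \<in> span_mod G rmon"
    by (simp add: rC_conv ncmul_distribs span_mod_sub B)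
  have Bm: "rB \<otimes> m \<in> span_mod G rmon" and BAB: "rB \<otimes> (rA \<otimes> (rB \<otimes> m)) \<in> span_mod G rmon"
    by (simp_all add: B)
  let ?q = "(-1/2) \<odot> (rB \<otimes> (rA \<otimes> (rC \<otimes> m)) \<oplus> rC \<otimes> (rA \<otimes> (rB \<otimes> m)))
        \<ominus> rA \<otimes> (rA \<otimes> m) \<oplus> rA \<otimes> (rdelta \<otimes> m)
        \<ominus> (3/16) \<odot> (rdelta \<otimes> (rdelta \<otimes> m)) \<oplus> (3/32) \<odot> (rdelta \<otimes> m) \<oplus> (9/256) \<odot> m"
  have "rD \<otimes> (rD \<otimes> m) \<ominus> ?q = (1/256) \<odot> (third_gen OmegaA \<otimes> m)
      \<ominus> rB \<otimes> rgamma \<otimes> m \<oplus> rC \<otimes> rbeta \<otimes> m"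
    by (rule ext) (simp add: third_gen_def OmegaA_def nc_ring_simps nc_apply algebra_simps)
  also have "\<dots> \<in> nc_ideal G"
    using m by (simp add: nc_ideal.add nc_ideal_sub nc_ideal_scale nc_ideal_lmul nc_ideal_rmul third)
  finally have "rD \<otimes> (rD \<otimes> m) \<ominus> ?q \<in> nc_ideal G" .
  moreover have "rC \<otimes> (rA \<otimes> (rB \<otimes> m)) \<in> span_mod G rmon"
    unfolding rC_conv by (intro span_mod_sub rA_span rdelta_span Bm BAB)
  then have "?q \<in> span_mod G rmon"
    by (intro span_mod_sub span_mod_add span_mod_scale rA_span rdelta_span BAC m)
  ultimately show ?thesis by (rule span_mod_cong[rotated])
qed

text \<open>At \<open>i = 0\<close>, \<beta> gives B\<Delta> = \<Delta>B - BA + CB modulo the ideal.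
  Everything then falls back on monomials free of \<Delta>, which is why those are treated
  beforehand.\<close>

lemma rBD_rmon_True:
  "rB \<otimes> rmon (i, True, k, s) \<in> span_mod G rmon \<and> rD \<otimes> rmon (i, True, k, s) \<in> span_mod G rmon"
proof (induction i)
  case 0
  let ?m = "rmon (0, False, k, s)"
  let ?q = "rD \<otimes> (rB \<otimes> ?m) \<ominus> rB \<otimes> (rA \<otimes> ?m) \<oplus> rC \<otimes> (rB \<otimes> ?m)"
  have "rB \<otimes> (rD \<otimes> ?m) \<ominus> ?q = rbeta \<otimes> ?m"
    by (rule ext) (simp add: rbeta_def nccomm_def nc_ring_simps nc_apply algebra_simps del: rmon.simps)
  then have "rB \<otimes> (rD \<otimes> ?m) \<ominus> ?q \<in> nc_ideal G"
    using rmon_ncpolys by (metis in_ideal(5) nc_ideal_rmul)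
  then have "rB \<otimes> (rD \<otimes> ?m) \<in> span_mod G rmon"
    by (rule span_mod_cong[rotated], unfold rC_conv rmon_Suc)
       (intro span_mod_sub span_mod_add rA_span rdelta_span; simp only: rmon_Suc rBD_rmon_False span_mod_gen)
  moreover have "rD \<otimes> (rD \<otimes> ?m) \<in> span_mod G rmon"
    by (intro rD_rD_span rmon_ncpolys span_mod_gen)
       (elim insertE emptyE; simp only: rmon_Suc rBD_rmon_False span_mod_gen)
  ultimately show ?case unfolding rmon_Suc(3)[symmetric] by blast
next
  case (Suc i)
  then show ?case
    unfolding rmon_Suc(1)[symmetric] using rBD_rA_span[OF rmon_ncpolys span_mod_gen] by blast
qed

lemma ncpolys_subset_span_rmon:
  assumes "p \<in> ncpolys" shows "p \<in> span_mod G rmon"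
proof (rule ncpolys_subset_span_mod[OF _ _ assms])
  have "ncconst 1 = rmon (0, False, 0, 0)" by (simp add: ncconst_mul)
  then show "ncconst 1 \<in> span_mod G rmon" using span_mod_gen by metis
  fix x and t :: "nat \<times> bool \<times> nat \<times> nat"
  obtain i j k s where t: "t = (i, j, k, s)" by (cases t)
  have BD: "rB \<otimes> rmon t \<in> span_mod G rmon" "rD \<otimes> rmon t \<in> span_mod G rmon"
    unfolding t by (cases j; simp only: rBD_rmon_False rBD_rmon_True)+
  then show "ncvar x \<otimes> rmon t \<in> span_mod G rmon"
    by (cases x) (auto simp: rC_conv simp del: rmon.simps
        intro!: span_mod_sub rA_span rdelta_span span_mod_gen)
qed

end

end

section \<open>Independence of the normal forms\<close>

lemma polyfun2_infinite_roots:
  fixes c :: "nat \<Rightarrow> nat \<Rightarrow> complex"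
  assumes X: "infinite X"
    and zero: "\<And>x y. x \<in> X \<Longrightarrow> (\<Sum>i\<le>n. \<Sum>j\<le>n. c i j * x ^ i * y ^ j) = 0"
    and le: "i \<le> n" "j \<le> n"
  shows "c i j = 0"
proof -
  have "(\<Sum>i\<le>n. c i j * x ^ i) = 0" if "x \<in> X" for x
  proof (rule polyfun_infinite_roots[OF infinite_UNIV_char_0 _ le(2)])
    fix y :: complex
    have "(\<Sum>j\<le>n. (\<Sum>i\<le>n. c i j * x ^ i) * y ^ j) = (\<Sum>i\<le>n. \<Sum>j\<le>n. c i j * x ^ i * y ^ j)"
      by (simp add: sum_distrib_right) (rule sum.swap)
    then show "(\<Sum>j\<le>n. (\<Sum>i\<le>n. c i j * x ^ i) * y ^ j) = 0" using zero[OF that] by simp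
  qed
  then show ?thesis using polyfun_infinite_roots[OF X _ le(1), of "\<lambda>i. c i j"] by blast
qed

text \<open>A and \<Delta> each raise the weight by at most 4, so only their raising terms reach the
  top; there \<Delta> has the coefficient \<open>- (m + 2) / 64\<close>. The zero case above the top
  is what removes the diagonal and lowering terms of A in the induction.\<close>

lemma act_rmon_unit_at:
  assumes "n \<ge> i + of_bool j"
  shows "act (rrep l) (rmon (i, j, k, s)) (unit_at m) (m + 4 * of_nat n)
    = (if n = i + of_bool j then (1/16) ^ i * (if j then - (m + 2) / 64 else 1)
         * ((m\<^sup>2 - 4) / 16) ^ k * (l / 8 - 3 / 4) ^ s else 0)"
proof -
  define x where "x = ((m\<^sup>2 - 4) / 16) ^ k * (l / 8 - 3 / 4) ^ s"
  have d: "(act (rrep l) rdelta ^^ s) f = (\<lambda>n. (l / 8 - 3 / 4) ^ s * f n)" for f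
    by (induction s) (auto simp: act_rrep_rdelta)
  have B: "(act (rrep l) rB ^^ k) (\<lambda>n. y * unit_at m n) = (\<lambda>n. ((m\<^sup>2 - 4) / 16) ^ k * y * unit_at m n)" for y
  proof (induction k)
    case (Suc k)
    show ?case unfolding funpow.simps o_apply Suc
      by (rule ext) (auto simp: act_var rrep_simps unit_at_def)
  qed simp
  define h where "h = act (rrep l) (if j then rD else ncconst 1) (\<lambda>n. x * unit_at m n)"
  define y where "y = (if j then - (m + 2) / 64 else 1) * x"
  have h: "h (m + 4 * of_nat n) = (if n = of_bool j then y else 0)" if "n \<ge> of_bool j" for n
  proof -
    have "m + 4 * of_nat n = m \<longleftrightarrow> n = 0" "m + 4 * of_nat n + 4 \<noteq> m"
      "m + 4 * of_nat n - 4 = m \<longleftrightarrow> n = 1" for n :: nat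
    proof -
      have "m + 4 * of_nat n + 4 - m = of_nat (4 * n + 4)" by simp
      then show "m + 4 * of_nat n + 4 \<noteq> m" by (metis add_is_0 diff_self of_nat_eq_0_iff zero_neq_numeral)
      have "m + 4 * of_nat n - 4 = m \<longleftrightarrow> of_nat n = (1 :: complex)" by (simp add: algebra_simps)
      then show "m + 4 * of_nat n - 4 = m \<longleftrightarrow> n = 1" by simp
    qed simp
    then show ?thesis using that
      by (auto simp: h_def y_def act_var act_const rrep_simps unit_at_def) (simp add: algebra_simps)
  qed
  have A: "(act (rrep l) rA ^^ i) h (m + 4 * of_nat n) = (if n = i + of_bool j then (1/16) ^ i * y else 0)"
    if "n \<ge> i + of_bool j" for n
    using that
  proof (induction i arbitrary: n)
    case 0
    then show ?case by (simp add: h)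
  next
    case (Suc i)
    then obtain n' where n: "n = Suc n'" by (cases n) auto
    let ?H = "(act (rrep l) rA ^^ i) h"
    have "(act (rrep l) rA ^^ Suc i) h (m + 4 * of_nat n) =
        (?H (m + 4 * of_nat n') + (l - (m + 4 * of_nat n)\<^sup>2 / 2 - 4) * ?H (m + 4 * of_nat n)
          + uquad l (m + 4 * of_nat n) * ?H (m + 4 * of_nat (Suc n))) / 16"
      by (simp add: act_var rrep_simps n algebra_simps)
    also have "\<dots> = ?H (m + 4 * of_nat n') / 16"
    proof -
      have "?H (m + 4 * of_nat n) = 0" "?H (m + 4 * of_nat (Suc n)) = 0"
        by (subst Suc.IH; use Suc.prems n in simp)+
      then show ?thesis by (simp only:) simp
    qed
    also have "\<dots> = (if n' = i + of_bool j then (1/16) ^ i * y else 0) / 16"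
      by (subst Suc.IH) (use Suc.prems n in auto)
    also have "\<dots> = (if n = Suc i + of_bool j then (1/16) ^ Suc i * y else 0)"
      by (simp add: n)
    finally show ?case .
  qed
  have "act (rrep l) (rmon (i, j, k, s)) (unit_at m) = (act (rrep l) rA ^^ i) h"
    by (simp add: h_def act_mul act_power linop_rrep d B x_def)
  then show ?thesis using A[OF assms] by (simp add: y_def x_def)
qed

text \<open>The monomials with maximal \<open>i + j\<close> are read off from the top weight \<open>m + 4(i + j)\<close>.  The ones
  with \<open>j = 0\<close> contribute an even function of \<open>m\<close> there and the ones with \<open>j = 1\<close> an even function
  times \<open>m + 2\<close>, so comparing \<open>m\<close> with \<open>-m\<close> separates them.\<close>
lemma rmon_independent:
  assumes fin: "finite {t. c t \<noteq> 0}"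
    and zero: "\<And>l f s. (\<Sum>t | c t \<noteq> 0. c t * act (rrep l) (rmon t) f s) = 0"
  shows "{t. c t \<noteq> 0} = {}"
proof (rule ccontr)
  assume ne: "{t. c t \<noteq> 0} \<noteq> {}"
  define wt :: "nat \<times> bool \<times> nat \<times> nat \<Rightarrow> nat" where "wt = (\<lambda>(i, j, k, s). i + of_bool j)"
  define N where "N = Max (wt ` {t. c t \<noteq> 0})"
  define ht :: "nat \<times> bool \<times> nat \<times> nat \<Rightarrow> nat" where "ht = (\<lambda>(i, j, k, s). max k s)"
  define K where "K = Max (ht ` {t. c t \<noteq> 0})"
  have N: "i + of_bool j \<le> N" if "c (i, j, k, s) \<noteq> 0" for i j k s
  proof -
    have "wt (i, j, k, s) \<le> N"
      unfolding N_def using fin that by (intro Max_ge finite_imageI imageI) auto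
    then show ?thesis by (simp add: wt_def)
  qed
  have K: "max k s \<le> K" if "c (i, j, k, s) \<noteq> 0" for i j k s
  proof -
    have "ht (i, j, k, s) \<le> K"
      unfolding K_def using fin that by (intro Max_ge finite_imageI imageI) auto
    then show ?thesis by (simp add: ht_def)
  qed
  have "N \<in> wt ` {t. c t \<noteq> 0}" unfolding N_def using fin ne by (intro Max_in) auto
  then obtain i0 j0 k0 s0 where t0: "c (i0, j0, k0, s0) \<noteq> 0" "i0 + of_bool j0 = N"
    by (auto simp: wt_def)
  define P where "P k s = c (N, False, k, s)" for k s
  \<comment> \<open>For \<open>N = 0\<close> no monomial with \<Delta> has top weight, while the
    natural number \<open>N - 1\<close> would wrongly select \<open>i = 0\<close>.\<close>
  define Q where "Q k s = (if N = 0 then 0 else c (N - 1, True, k, s))" for k s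
  define ev where "ev R x y = (\<Sum>k\<le>K. \<Sum>s\<le>K. R k s * x ^ k * y ^ s)" for R :: "nat \<Rightarrow> nat \<Rightarrow> complex" and x y
  \<comment> \<open>The factor \<open>(m + 2) / 4\<close> arises because a monomial with \<Delta>
    has one A less, hence one factor \<open>1/16\<close> less.\<close>
  have top: "ev P ((m\<^sup>2 - 4) / 16) y - (m + 2) / 4 * ev Q ((m\<^sup>2 - 4) / 16) y = 0" for m y
  proof -
    \<comment> \<open>With this \<open>l\<close> the element \<delta> acts as \<open>y\<close>, so
      \<open>y\<close> is a free variable.\<close>
    define l where "l = 8 * y + 6"
    define x where "x = (m\<^sup>2 - 4) / 16"
    have y: "l / 8 - 3 / 4 = y" by (simp add: l_def field_simps)
    let ?w = "\<lambda>t. c t * act (rrep l) (rmon t) (unit_at m) (m + 4 * of_nat N)"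
    let ?h = "\<lambda>i j. if N = i + of_bool j then (1/16) ^ i * (if j then - (m + 2) / 64 else 1) else (0 :: complex)"
    have w: "?w (i, j, k, s) = ?h i j * (c (i, j, k, s) * x ^ k * y ^ s)" for i j k s
    proof (cases "c (i, j, k, s) = 0")
      case False
      then show ?thesis
        by (simp only: act_rmon_unit_at[OF N[OF False]] y x_def) simp
    qed simp
    have "0 = (\<Sum>t | c t \<noteq> 0. ?w t)" using zero by simp
    also have "\<dots> = (\<Sum>t\<in>{..N} \<times> UNIV \<times> {..K} \<times> {..K}. ?w t)"
    proof (rule sum.mono_neutral_left)
      show "{t. c t \<noteq> 0} \<subseteq> {..N} \<times> UNIV \<times> {..K} \<times> {..K}"
      proof
        fix t assume "t \<in> {t. c t \<noteq> 0}"
        then show "t \<in> {..N} \<times> UNIV \<times> {..K} \<times> {..K}"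
          by (cases t) (auto dest: N K)
      qed
    qed auto
    also have "\<dots> = (\<Sum>i\<le>N. \<Sum>j\<in>UNIV. \<Sum>k\<le>K. \<Sum>s\<le>K. ?w (i, j, k, s))"
      by (simp add: sum.cartesian_product' del: rmon.simps)
    also have "\<dots> = (\<Sum>i\<le>N. \<Sum>j\<in>UNIV. ?h i j * ev (\<lambda>k s. c (i, j, k, s)) x y)"
      unfolding w ev_def by (simp add: sum_distrib_left)
    also have "\<dots> = (\<Sum>i\<le>N. (if i = N then (1/16) ^ N * ev P x y else 0)
        + (if Suc i = N then (1/16) ^ i * (- (m + 2) / 64) * ev Q x y else 0))"
      by (intro sum.cong refl) (auto simp: UNIV_bool P_def[abs_def] Q_def[abs_def])
    also have "\<dots> = (1/16) ^ N * (ev P x y - (m + 2) / 4 * ev Q x y)"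
    proof (cases N)
      case 0
      then show ?thesis by (simp add: ev_def Q_def)
    next
      case (Suc n)
      have "(\<Sum>i\<le>N. (if i = N then u else 0) + (if Suc i = N then v i else 0)) = u + v n"
        for u :: complex and v
        by (simp add: Suc sum.distrib)
      then show ?thesis by (simp only: Suc power_Suc) (simp add: field_simps)
    qed
    finally show ?thesis by (simp add: x_def)
  qed
  \<comment> \<open>The excluded value of \<open>x\<close> corresponds to \<open>m = 0\<close>,
    where \<open>m\<close> and \<open>-m\<close> coincide and yield only one equation.\<close>
  have PQ: "ev P x y = 0 \<and> ev Q x y = 0" if "x \<in> - {-1/4}" for x y
  proof -
    define m where "m = csqrt (16 * x + 4)"
    have m2: "m\<^sup>2 = 16 * x + 4" by (simp add: m_def)
    have "m \<noteq> 0"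
    proof
      assume "m = 0"
      then have "16 * x = - 4" using m2 by (simp add: eq_neg_iff_add_eq_0)
      then have "x = - 1 / 4" by (simp add: field_simps)
      then show False using that by simp
    qed
    have eqs: "ev P x y - (m + 2) / 4 * ev Q x y = 0" "ev P x y - (- m + 2) / 4 * ev Q x y = 0"
      using top[of m y] top[of "- m" y] by (simp_all add: m2)
    have "m * ev Q x y = 2 * ((ev P x y - (- m + 2) / 4 * ev Q x y) - (ev P x y - (m + 2) / 4 * ev Q x y))"
      by (simp add: field_simps)
    then have "ev Q x y = 0" using \<open>m \<noteq> 0\<close> unfolding eqs by simp
    then show ?thesis using eqs(1) by simp
  qed
  have inf: "infinite (- {-1/4 :: complex})" by (simp add: infinite_UNIV_char_0)
  have "P k0 s0 = 0"
    by (rule polyfun2_infinite_roots[OF inf, where c = P and n = K])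
       (use PQ K[OF t0(1)] in \<open>simp_all add: ev_def\<close>)
  moreover have "Q k0 s0 = 0"
    by (rule polyfun2_infinite_roots[OF inf, where c = Q and n = K])
       (use PQ K[OF t0(1)] in \<open>simp_all add: ev_def\<close>)
  ultimately show False using t0 by (cases j0) (auto simp: P_def Q_def split: if_splits)
qed

section \<open>The kernel and minimality\<close>

lemma ker_sharp_lift_iff:
  "p \<in> ker_sharp_lift \<longleftrightarrow> p \<in> ncpolys \<and> (\<forall>l f. act (rrep l) p f = (\<lambda>m. 0))"
proof -
  have "act (urep l) (ncsubst sharp_gen p) f = act (rrep l) p f" if "p \<in> ncpolys" for l f
    using act_ncsubst[OF that sharp_gen_ncpolys linop_urep] by (simp add: rrep_def[abs_def])
  then show ?thesis
    unfolding ker_sharp_lift_def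
    using nc_ideal_RelU_iff[OF ncpolys_ncsubst[of p sharp_gen, OF _ sharp_gen_ncpolys]] by auto
qed

text \<open>Commutators vanish in dimension one, which forces \<Delta> = 0. No condition on
  \<open>a\<close>, \<open>b\<close>, \<open>c\<close> remains, since \<alpha>, \<beta>, \<gamma>
  act as scalars.\<close>

definition char_rep :: "complex \<Rightarrow> complex \<Rightarrow> complex \<Rightarrow> rgen \<Rightarrow> (unit \<Rightarrow> complex) \<Rightarrow> unit \<Rightarrow> complex" where
  "char_rep a b c x f = (\<lambda>t. (case x of GA \<Rightarrow> a | GB \<Rightarrow> b | GC \<Rightarrow> c | GD \<Rightarrow> 0) * f t)"

lemma linop_char_rep: "linop (char_rep a b c x)"
  by (auto simp: linop_def char_rep_def algebra_simps)

lemma act_char_rep: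
  "act (char_rep a b c) ralpha f = (\<lambda>t. a * (c - b) * f t)"
  "act (char_rep a b c) rbeta f = (\<lambda>t. b * (a - c) * f t)"
  "act (char_rep a b c) rgamma f = (\<lambda>t. c * (b - a) * f t)"
  "act (char_rep a b c) rdelta f = (\<lambda>t. (a + b + c) * f t)"
  by (rule ext, simp add: ralpha_def rbeta_def rgamma_def rdelta_def nccomm_def act_simps
      linop_char_rep, simp add: char_rep_def algebra_simps)+

lemma char_rep_RelR: "g \<in> RelR \<Longrightarrow> act (char_rep a b c) g f = (\<lambda>t. 0)"
proof -
  have "act (char_rep a b c) (nccomm z (ncvar x)) f = (\<lambda>t. 0)" if "z \<in> {ralpha, rbeta, rgamma}" for z x
  proof -
    have "\<exists>y. \<forall>f. act (char_rep a b c) z f = (\<lambda>t. y * f t)"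
      using that by (elim insertE emptyE; simp only: act_char_rep) (rule exI, rule allI, rule refl)+
    then obtain y where y: "\<And>f. act (char_rep a b c) z f = (\<lambda>t. y * f t)" by blast
    have "z \<in> ncpolys" using that by auto
    then show ?thesis
      by (simp add: nccomm_def act_simps linop_char_rep y) (simp add: char_rep_def)
  qed
  moreover have "act (char_rep a b c) (nccomm (ncvar x) (ncvar y) \<ominus> 2 \<odot> rD) f = (\<lambda>t. 0)" for x y
    by (simp add: nccomm_def act_simps linop_char_rep) (simp add: char_rep_def)
  ultimately show "g \<in> RelR \<Longrightarrow> ?thesis" unfolding RelR_def by auto
qed

lemma not_in_nc_ideal_RelR:
  assumes "H \<subseteq> ncpolys" "\<And>h f. h \<in> H \<Longrightarrow> act (char_rep a b c) h f = (\<lambda>t. 0)"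
    and "act (char_rep a b c) p (\<lambda>t. 1) () \<noteq> 0"
  shows "p \<notin> nc_ideal (RelR \<union> H)"
proof
  assume "p \<in> nc_ideal (RelR \<union> H)"
  then have "p \<in> ncpolys \<and> (\<forall>f. act (char_rep a b c) p f = (\<lambda>t. 0))"
    by (rule nc_ideal_annihilated)
       (use assms(1,2) RelR_ncpolys linop_char_rep char_rep_RelR in blast)+
  then show False using assms(3) by simp
qed

lemma act_char_rep_Omega:
  "act (char_rep a b c) OmegaA f
    = (\<lambda>t. (a * b * c + b * (c * (b - a)) - c * (b * (a - c)) - a * b - a * c) * f t)"
  "act (char_rep a b c) OmegaB f
    = (\<lambda>t. (a * b * c + c * (a * (c - b)) - a * (c * (b - a)) - b * c - b * a) * f t)"
  "act (char_rep a b c) OmegaC f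
    = (\<lambda>t. (a * b * c + a * (b * (a - c)) - b * (a * (c - b)) - c * a - c * b) * f t)"
  by (rule ext, simp add: OmegaA_def OmegaB_def OmegaC_def act_simps linop_char_rep act_char_rep,
      simp add: char_rep_def algebra_simps)+

lemma act_char_rep_third_gen:
  assumes "\<And>f. act (char_rep a b c) \<Omega> f = (\<lambda>t. y * f t)" "\<Omega> \<in> ncpolys"
  shows "act (char_rep a b c) (third_gen \<Omega>) f
    = (\<lambda>t. (256 * y + 3 * (4 * (a + b + c) - 3) * (4 * (a + b + c) + 1)) * f t)"
  by (rule ext, simp add: third_gen_def act_simps linop_char_rep act_char_rep assms)
     (simp add: algebra_simps)

theorem theorem1p5:
  assumes "\<Omega> \<in> {OmegaA, OmegaB, OmegaC}"
  shows "nc_ideal (RelR \<union> {ralpha, rbeta, third_gen \<Omega>}) = ker_sharp_lift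
       \<and> ralpha \<notin> nc_ideal (RelR \<union> {rbeta, third_gen \<Omega>})
       \<and> rbeta \<notin> nc_ideal (RelR \<union> {ralpha, third_gen \<Omega>})
       \<and> third_gen \<Omega> \<notin> nc_ideal (RelR \<union> {ralpha, rbeta})"
proof (intro conjI)
  let ?G = "RelR \<union> {ralpha, rbeta, third_gen \<Omega>}"
  have \<Omega> [simp]: "\<Omega> \<in> ncpolys" using assms by auto
  have G: "?G \<subseteq> ncpolys" using RelR_ncpolys by simp
  \<comment> \<open>Only \<open>OmegaA\<close> was computed; the other two choices differ from it by
    elements of the ideal of \<alpha> and \<beta>, which act as zero.\<close>
  have third_act: "act (rrep l) (third_gen \<Omega>) f = (\<lambda>m. 0)" for l f
  proof -
    have "third_gen OmegaA \<ominus> third_gen \<Omega> \<in> nc_ideal (RelR \<union> {ralpha, rbeta})"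
      using third_gen_diff_in_ideal[OF order.refl assms] .
    then have "third_gen OmegaA \<ominus> third_gen \<Omega> \<in> ncpolys \<and>
        (\<forall>f. act (rrep l) (third_gen OmegaA \<ominus> third_gen \<Omega>) f = (\<lambda>m. 0))"
      by (rule nc_ideal_annihilated)
         (use RelR_ncpolys linop_rrep act_rrep_RelR act_rrep_ralpha act_rrep_rbeta in auto)
    then show ?thesis by (simp add: act_sub act_rrep_third_OmegaA fun_eq_iff)
  qed
  have G_act: "act (rrep l) g f = (\<lambda>m. 0)" if "g \<in> ?G" for g l f
    using that act_rrep_RelR act_rrep_ralpha act_rrep_rbeta third_act by auto
  have third: "third_gen OmegaA \<in> nc_ideal ?G"
  proof -
    have "third_gen OmegaA = (third_gen OmegaA \<ominus> third_gen \<Omega>) \<oplus> third_gen \<Omega>"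
      by (simp add: nc_pointwise)
    moreover have "third_gen OmegaA \<ominus> third_gen \<Omega> \<in> nc_ideal ?G"
      by (rule third_gen_diff_in_ideal[OF _ assms]) auto
    moreover have "third_gen \<Omega> \<in> nc_ideal ?G" by (rule nc_ideal.gen) simp
    ultimately show ?thesis by (metis nc_ideal.add)
  qed
  show "nc_ideal ?G = ker_sharp_lift"
  proof
    show "nc_ideal ?G \<subseteq> ker_sharp_lift"
      using nc_ideal_annihilated[OF _ G linop_rrep G_act] by (auto simp: ker_sharp_lift_iff)
    show "ker_sharp_lift \<subseteq> nc_ideal ?G"
    proof
      fix p assume "p \<in> ker_sharp_lift"
      then have p: "p \<in> ncpolys" "\<And>l f. act (rrep l) p f = (\<lambda>m. 0)"
        by (auto simp: ker_sharp_lift_iff)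
      have "p \<in> span_mod ?G rmon"
        by (rule ncpolys_subset_span_rmon[OF _ third p(1)]) auto
      from nc_ideal_if_annihilated[where \<rho> = rrep, OF G linop_rrep G_act rmon_ncpolys p(1) this p(2) rmon_independent]
      show "p \<in> nc_ideal ?G" by blast
    qed
  qed
  \<comment> \<open>The value -1 of \<delta> makes the three Casimir elements agree, their
    differences being multiples of 1 + \<delta>. With one of \<open>a\<close>, \<open>b\<close>
    equal to 0, the third element then vanishes iff the other two values have product 63/256; with
    sum -1 they are -9/16 and -7/16. At the origin only 3 * (-3) * 1 = -9 is left.\<close>
  have third_char: "act (char_rep a b c) (third_gen \<Omega>) f = (\<lambda>t. y * f t)"
    if "(a, b, c, y) \<in> {(-9/16, 0, -7/16, 0), (0, -9/16, -7/16, 0), (0, 0, 0, -9)}" for a b c y f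
    using assms that
    by (auto simp: act_char_rep_third_gen[OF act_char_rep_Omega(1)]
        act_char_rep_third_gen[OF act_char_rep_Omega(2)] act_char_rep_third_gen[OF act_char_rep_Omega(3)])
  show "ralpha \<notin> nc_ideal (RelR \<union> {rbeta, third_gen \<Omega>})"
    by (rule not_in_nc_ideal_RelR[of _ "-9/16" 0 "-7/16"])
       (auto simp: act_char_rep third_char[where y = 0])
  show "rbeta \<notin> nc_ideal (RelR \<union> {ralpha, third_gen \<Omega>})"
    by (rule not_in_nc_ideal_RelR[of _ 0 "-9/16" "-7/16"])
       (auto simp: act_char_rep third_char[where y = 0])
  show "third_gen \<Omega> \<notin> nc_ideal (RelR \<union> {ralpha, rbeta})"
    by (rule not_in_nc_ideal_RelR[of _ 0 0 0])
       (auto simp: act_char_rep third_char[where y = "-9"])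
qed

end
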